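(* For any $\alpha\in(0,1)$, $$\lim_{K\to\infty}\frac1K\left(Z(\hat{\boldsymbol\pi},\lfloor\alpha K\rfloor,K)-\max_{\boldsymbol\pi\in\boldsymbol\Pi_{\lfloor\alpha K\rfloor,K}}Z(\boldsymbol\pi,\lfloor\alpha K\rfloor,K)\right)=0,$$ where, for each $K$, $\hat{\boldsymbol\pi}$ is the index policy for the restless bandit with $K$ arms and $m=\lfloor\alpha K\rfloor$ activations per period.
   Context: **Arms.** Fix a horizon $T<\infty$, a finite state space $\mathbb S$, the action set $\mathbb A=\{0,1\}$ ($1$ = active, $0$ = inactive), transition kernels $P^a(s',s)$ (the probability that an arm, also called a sub-process, moves from state $s'$ to state $s$ when action $a$ is taken), finite non-negative rewards $r_t(s,a)$ ($1\le t\le T$), and an initial state $s_1\in\mathbb S$. No restriction is put on $P^0$. **The $K$-arm problem.** There are $K$ arms, all starting in state $s_1$. The joint state is $\mathbf S_t=(S_{t,1},\dots,S_{t,K})\in\mathbb S^K$ and the joint action is $\mathbf A_t\in\{0,1\}^K$. Given $\mathbf S_t,\mathbf A_t$, the arms move independently, each according to $P^{a}$ with its own action $a$. The total reward at time $t$ is $R_t(\mathbf s,\mathbf a)=\sum_{x=1}^K r_t(s_x,a_x)$. For a vector $\mathbf v$, $|\mathbf v|$ denotes the sum of its entries. A (randomized) Markov policy $\boldsymbol\pi(\mathbf s,\mathbf a,t)$ gives the probability of taking $\mathbf a$ in state $\mathbf s$ at time $t$; $\boldsymbol\Pi$ is the set of all of them. $\boldsymbol\Pi_{m,K}$ is the set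 of Markov policies for the $K$-arm problem with $P^{\boldsymbol\pi}(|\mathbf A_t|=m)=1$ for all $1\le t\le T$. $Z(\boldsymbol\pi,m,K)=\mathbb E^{\boldsymbol\pi}[\sum_{t=1}^T R_t(\mathbf S_t,\mathbf A_t)]$ is the expected total reward. **Single-arm problem.** For $\boldsymbol\lambda\in\mathbb R^T$ let $Q(\boldsymbol\lambda)=\max_{\pi}\mathbb E^{\pi}[\sum_{t=1}^T (r_t(S_t,A_t)-\lambda_tA_t)]$, the maximum over Markov policies $\pi(s,a,t)$ of a single arm started at $s_1$. Its value function is $V^{\boldsymbol\lambda}(s,T)=\max_a\{r_T(s,a)-a\lambda_T\}$ and, for $t<T$, $V^{\boldsymbol\lambda}(s,t)=\max_a\{r_t(s,a)-a\lambda_t+\sum_{s'}P^a(s,s')V^{\boldsymbol\lambda}(s',t+1)\}$. $\Pi^*(\boldsymbol\lambda)$ is the set of deterministic Markov policies which for every $(s,t)$ choose an action attaining this maximum. **Multiplier.** Let $P(\boldsymbol\lambda,m,K)=\max_{\boldsymbol\pi\in\boldsymbol\Pi}\left\{\mathbb E^{\boldsymbol\pi}[\sum_t R_t(\mathbf S_t,\mathbf A_t)]-\mathbb E^{\boldsymbol\pi}[\sum_t\lambda_t(|\mathbf A_t|-m)]\right\}$, which equals $KQ(\boldsymbol\lambda)+m\sum_t\lambda_t$. Let $\boldsymbol\lambda^*$ be any element of $\arg\inf_{\boldsymbol\lambda\in\mathbb R^T}P(\boldsymbol\lambda,\alpha K,K)$, i.e. any minimizer of $Q(\boldsymbol\lambda)+\alpha\sum_t\lambda_t$;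 it depends on $\alpha$ but not on $K$, and the same choice is used for all $K$. **Indices.** $\boldsymbol\lambda^*[\beta,t]$ is $\boldsymbol\lambda^*$ with its $t$-th entry replaced by $\beta$, and $\beta_t(s)=\sup\{\beta\in\mathbb R:\exists\,\pi\in\Pi^*(\boldsymbol\lambda^*[\beta,t])\text{ with }\pi(s,1,t)=1\}$. **Occupation measure $\rho$.** $\rho$ is a fixed optimal solution of the linear program: maximize $\sum_{t,a,s}\rho(s,a,t)(r_t(s,a)-\lambda_t^*\mathbf 1(a=1))$ subject to $\sum_s\rho(s,1,t)=\alpha$ for all $t$; $\sum_a\rho(s,a,t)=\sum_a\sum_{s'}\rho(s',a,t-1)P^a(s',s)$ for all $s$ and $2\le t\le T$; $\sum_a\rho(s,a,1)=\mathbf 1(s=s_1)$ for all $s$; $\rho\ge0$. **Index policy $\hat{\boldsymbol\pi}$** (for $m=\lfloor\alpha K\rfloor\geq 1$). At each time $t$, let $N_t(s)$ be the number of arms in state $s$, let $\bar\beta_t$ be the $m$-th largest entry of the list $\beta_t(S_{t,1}),\dots,\beta_t(S_{t,K})$, and let $I_t=\{s:\beta_t(s)=\bar\beta_t,\ N_t(s)\ge1\}$. For $s\in I_t$ put $q(s)=\rho(s,1,t)/\sum_{s'\in I_t}\rho(s',1,t)$ if the denominator is positive and $q(s)=N_t(s)/\sum_{s'\in I_t}N_t(s')$ otherwise. Let $b=\mathrm{Rounding}\big(m-\sum_{s':\beta_t(s')>\bar\beta_t}N_t(s'),\,(q(s))_{s\in I_t},\,(N_t(s))_{s\in I_t}\big)$.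 All arms in states with $\beta_t(s)>\bar\beta_t$ are set active; in each $s\in I_t$ exactly $b(s)$ arms are set active; arms in states with $\beta_t(s)<\bar\beta_t$ are inactive. $\mathrm{Rounding}(\text{total},\text{frac},\text{avail})$, for vectors of length $n$ (entries listed in a fixed order) with $\sum_i\text{frac}_i=1$ and $\text{total}\le\sum_i\text{avail}_i$: initialize $b_i=\min\{\text{avail}_i,\lfloor\text{total}\cdot\text{frac}_i\rfloor\}$ and $j=1$; while $\sum_ib_i<\text{total}$, replace $b_j$ by $b_j+\mathbf 1(\text{avail}_j>b_j)$ and then $j$ by $(j\bmod n)+1$; output $b$. Only $K$ large enough that $\lfloor\alpha K\rfloor\ge1$ matter for the limit. *)

theory Defs
  imports "HOL-Probability.Probability" "HOL-Library.While_Combinator"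
begin

section \<open>Finite-horizon Markov decision processes\<close>

text \<open>
  Actions of a single arm are of type \<^typ>\<open>bool\<close> (\<^term>\<open>True\<close> is the active action 1).
  The kernel value $P^a(s,s')$ is \<^term>\<open>pmf (P a s) s'\<close>, and a policy value $\pi(s,a,t)$
  is \<^term>\<open>pmf (\<pi> t s) a\<close>. Periods are numbered $1, \ldots, T$; a multiplier vector in
  $\mathbb{R}^T$ is a function on \<^typ>\<open>nat\<close> of which only the entries $1, \ldots, T$ are ever used.
\<close>

type_synonym ('x, 'y) policy = "nat \<Rightarrow> 'x \<Rightarrow> 'y pmf"

type_synonym 's kernel = "bool \<Rightarrow> 's \<Rightarrow> 's pmf"

type_synonym 's reward = "nat \<Rightarrow> 's \<Rightarrow> bool \<Rightarrow> real"

text \<open>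
  Law of the next \<open>n\<close> state-action pairs of the controlled chain which is in state
  \<open>s\<close> at time \<open>t\<close>.
\<close>

primrec run :: "('x \<Rightarrow> 'y \<Rightarrow> 'x pmf) \<Rightarrow> ('x, 'y) policy \<Rightarrow> nat \<Rightarrow> nat \<Rightarrow> 'x \<Rightarrow> ('x \<times> 'y) list pmf"
where
  "run D \<pi> 0 t s = return_pmf []"
| "run D \<pi> (Suc n) t s =
     bind_pmf (\<pi> t s) (\<lambda>a. bind_pmf (D s a) (\<lambda>s'.
       map_pmf (\<lambda>h. (s, a) # h) (run D \<pi> n (Suc t) s')))"

definition state_at :: "('x \<times> 'y) list \<Rightarrow> nat \<Rightarrow> 'x" where
  "state_at h t = fst (h ! (t - 1))"

definition action_at :: "('x \<times> 'y) list \<Rightarrow> nat \<Rightarrow> 'y" where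
  "action_at h t = snd (h ! (t - 1))"


section \<open>The K-arm problem\<close>

text \<open>
  The arms are numbered $0, \ldots, K - 1$. Vectors with $K$ entries are functions on \<^typ>\<open>nat\<close>:
  states are constantly \<open>s1\<close> and actions constantly \<^term>\<open>False\<close> outside \<^term>\<open>{..<K}\<close>.
\<close>

definition joint_kernel ::
  "'s kernel \<Rightarrow> 's \<Rightarrow> nat \<Rightarrow> (nat \<Rightarrow> 's) \<Rightarrow> (nat \<Rightarrow> bool) \<Rightarrow> (nat \<Rightarrow> 's) pmf" where
  "joint_kernel P s1 K s a = Pi_pmf {..<K} s1 (\<lambda>x. P (a x) (s x))"

definition joint_reward :: "'s reward \<Rightarrow> nat \<Rightarrow> nat \<Rightarrow> (nat \<Rightarrow> 's) \<Rightarrow> (nat \<Rightarrow> bool) \<Rightarrow> real" where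
  "joint_reward r K t s a = (\<Sum>x<K. r t (s x) (a x))"

definition num_active :: "nat \<Rightarrow> (nat \<Rightarrow> bool) \<Rightarrow> nat" where
  "num_active K a = (\<Sum>x<K. of_bool (a x))"

definition policies :: "nat \<Rightarrow> (nat \<Rightarrow> 's, nat \<Rightarrow> bool) policy set" where
  "policies K = {\<pi>. \<forall>t s. set_pmf (\<pi> t s) \<subseteq> {a. \<forall>x\<ge>K. \<not> a x}}"

definition trajectory ::
  "nat \<Rightarrow> 's kernel \<Rightarrow> 's \<Rightarrow> nat \<Rightarrow> (nat \<Rightarrow> 's, nat \<Rightarrow> bool) policy
     \<Rightarrow> ((nat \<Rightarrow> 's) \<times> (nat \<Rightarrow> bool)) list pmf" where
  "trajectory T P s1 K \<pi> = run (joint_kernel P s1 K) \<pi> T 1 (\<lambda>_. s1)"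

definition policies_active ::
  "nat \<Rightarrow> 's kernel \<Rightarrow> 's \<Rightarrow> nat \<Rightarrow> nat \<Rightarrow> (nat \<Rightarrow> 's, nat \<Rightarrow> bool) policy set" where
  "policies_active T P s1 m K =
     {\<pi> \<in> policies K. \<forall>t\<in>{1..T}.
        measure_pmf.prob (trajectory T P s1 K \<pi>) {h. num_active K (action_at h t) = m} = 1}"

definition total_reward ::
  "nat \<Rightarrow> 's kernel \<Rightarrow> 's reward \<Rightarrow> 's \<Rightarrow> nat \<Rightarrow> (nat \<Rightarrow> 's, nat \<Rightarrow> bool) policy \<Rightarrow> real" where
  "total_reward T P r s1 K \<pi> =
     measure_pmf.expectation (trajectory T P s1 K \<pi>)
       (\<lambda>h. \<Sum>t=1..T. joint_reward r K t (state_at h t) (action_at h t))"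


section \<open>Lagrange multipliers\<close>

definition lagrangian ::
  "nat \<Rightarrow> 's kernel \<Rightarrow> 's reward \<Rightarrow> 's \<Rightarrow> (nat \<Rightarrow> real) \<Rightarrow> real \<Rightarrow> nat \<Rightarrow> real" where
  "lagrangian T P r s1 lam m K =
     (SUP \<pi>\<in>policies K.
        total_reward T P r s1 K \<pi>
        - measure_pmf.expectation (trajectory T P s1 K \<pi>)
            (\<lambda>h. \<Sum>t=1..T. lam t * (real (num_active K (action_at h t)) - m)))"

text \<open>
  The set of minimizers does not depend on $K \ge 1$: the Lagrangian equals $K Q + m \sum_t \lambda_t$,
  where $Q$ is the optimal value of a single arm charged $\lambda_t$ per activation.
\<close>

definition multipliers ::
  "nat \<Rightarrow> 's kernel \<Rightarrow> 's reward \<Rightarrow> 's \<Rightarrow> real \<Rightarrow> nat \<Rightarrow> (nat \<Rightarrow> real) set" where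
  "multipliers T P r s1 \<alpha> K =
     {lam. \<forall>lam'. lagrangian T P r s1 lam (\<alpha> * real K) K \<le> lagrangian T P r s1 lam' (\<alpha> * real K) K}"


section \<open>Single-arm value function and indices\<close>

definition action_value ::
  "'s kernel \<Rightarrow> 's reward \<Rightarrow> (nat \<Rightarrow> real) \<Rightarrow> ('s \<Rightarrow> real) \<Rightarrow> 's::finite \<Rightarrow> nat \<Rightarrow> bool \<Rightarrow> real" where
  "action_value P r lam W s t a =
     r t s a - of_bool a * lam t + (\<Sum>s'\<in>UNIV. pmf (P a s) s' * W s')"

text \<open>For \<open>t = T\<close> (and beyond) the continuation value is zero.\<close>

function val ::
  "nat \<Rightarrow> 's kernel \<Rightarrow> 's reward \<Rightarrow> (nat \<Rightarrow> real) \<Rightarrow> nat \<Rightarrow> 's::finite \<Rightarrow> real" where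
  "val T P r lam t s =
     (MAX a\<in>UNIV. action_value P r lam (if t < T then val T P r lam (Suc t) else (\<lambda>_. 0)) s t a)"
  by auto
termination
  by (relation "Wellfounded.measure (\<lambda>(T, P, r, lam, t, s). T - t)") auto

declare val.simps [simp del]

definition optimal_policies ::
  "nat \<Rightarrow> 's kernel \<Rightarrow> 's reward \<Rightarrow> (nat \<Rightarrow> real) \<Rightarrow> ('s::finite, bool) policy set" where
  "optimal_policies T P r lam =
     {\<pi>. \<forall>t\<in>{1..T}. \<forall>s. \<exists>a. \<pi> t s = return_pmf a \<and>
        action_value P r lam (if t < T then val T P r lam (Suc t) else (\<lambda>_. 0)) s t a
          = val T P r lam t s}"

definition arm_index ::
  "nat \<Rightarrow> 's kernel \<Rightarrow> 's reward \<Rightarrow> (nat \<Rightarrow> real) \<Rightarrow> nat \<Rightarrow> 's::finite \<Rightarrow> real" where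
  "arm_index T P r lam t s =
     Sup {\<beta>. \<exists>\<pi>\<in>optimal_policies T P r (lam(t := \<beta>)). pmf (\<pi> t s) True = 1}"


section \<open>Occupation measures\<close>

definition occupation_feasible ::
  "nat \<Rightarrow> 's kernel \<Rightarrow> 's \<Rightarrow> real \<Rightarrow> ('s::finite \<Rightarrow> bool \<Rightarrow> nat \<Rightarrow> real) \<Rightarrow> bool" where
  "occupation_feasible T P s1 \<alpha> \<rho> \<longleftrightarrow>
     (\<forall>t\<in>{1..T}. (\<Sum>s\<in>UNIV. \<rho> s True t) = \<alpha>) \<and>
     (\<forall>t\<in>{2..T}. \<forall>s.
        (\<Sum>a\<in>UNIV. \<rho> s a t) = (\<Sum>a\<in>UNIV. \<Sum>s'\<in>UNIV. \<rho> s' a (t - 1) * pmf (P a s') s)) \<and>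
     (\<forall>s. (\<Sum>a\<in>UNIV. \<rho> s a 1) = of_bool (s = s1)) \<and>
     (\<forall>t\<in>{1..T}. \<forall>s a. 0 \<le> \<rho> s a t)"

definition occupation_objective ::
  "nat \<Rightarrow> 's reward \<Rightarrow> (nat \<Rightarrow> real) \<Rightarrow> ('s::finite \<Rightarrow> bool \<Rightarrow> nat \<Rightarrow> real) \<Rightarrow> real" where
  "occupation_objective T r lam \<rho> =
     (\<Sum>t=1..T. \<Sum>a\<in>UNIV. \<Sum>s\<in>UNIV. \<rho> s a t * (r t s a - lam t * of_bool a))"

definition occupation_optimal ::
  "nat \<Rightarrow> 's kernel \<Rightarrow> 's reward \<Rightarrow> 's \<Rightarrow> real \<Rightarrow> (nat \<Rightarrow> real)
     \<Rightarrow> ('s::finite \<Rightarrow> bool \<Rightarrow> nat \<Rightarrow> real) \<Rightarrow> bool" where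
  "occupation_optimal T P r s1 \<alpha> lam \<rho> \<longleftrightarrow>
     occupation_feasible T P s1 \<alpha> \<rho> \<and>
     (\<forall>\<rho>'. occupation_feasible T P s1 \<alpha> \<rho>' \<longrightarrow>
        occupation_objective T r lam \<rho>' \<le> occupation_objective T r lam \<rho>)"


section \<open>The index policy\<close>

text \<open>List positions start at 0, so the cyclic pointer goes from \<open>j\<close> to \<open>(j + 1) mod n\<close>.\<close>

definition rounding :: "nat \<Rightarrow> real list \<Rightarrow> nat list \<Rightarrow> nat list" where
  "rounding amount fracs avail =
     fst (while (\<lambda>(b, j). sum_list b < amount)
       (\<lambda>(b, j). (b[j := b ! j + of_bool (avail ! j > b ! j)], (j + 1) mod length avail))
       (map2 (\<lambda>v f. min v (nat \<lfloor>real amount * f\<rfloor>)) avail fracs, 0))"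

definition num_in_state :: "nat \<Rightarrow> (nat \<Rightarrow> 's) \<Rightarrow> 's \<Rightarrow> nat" where
  "num_in_state K s z = card {x. x < K \<and> s x = z}"

definition threshold :: "('s \<Rightarrow> real) \<Rightarrow> nat \<Rightarrow> nat \<Rightarrow> (nat \<Rightarrow> 's) \<Rightarrow> real" where
  "threshold \<beta> m K s = rev (sort (map (\<lambda>x. \<beta> (s x)) [0..<K])) ! (m - 1)"

definition tied_states :: "('s \<Rightarrow> real) \<Rightarrow> nat \<Rightarrow> nat \<Rightarrow> (nat \<Rightarrow> 's) \<Rightarrow> 's set" where
  "tied_states \<beta> m K s = {z. \<beta> z = threshold \<beta> m K s \<and> 1 \<le> num_in_state K s z}"

text \<open>In the next three definitions \<open>\<rho>1\<close> stands for $\rho(\cdot,1,t)$, and \<open>\<beta>\<close> for $\beta_t$.\<close>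

definition tie_fraction ::
  "('s \<Rightarrow> real) \<Rightarrow> ('s \<Rightarrow> real) \<Rightarrow> nat \<Rightarrow> nat \<Rightarrow> (nat \<Rightarrow> 's) \<Rightarrow> 's \<Rightarrow> real" where
  "tie_fraction \<beta> \<rho>1 m K s z =
     (let I = tied_states \<beta> m K s in
      if (\<Sum>z'\<in>I. \<rho>1 z') > 0 then \<rho>1 z / (\<Sum>z'\<in>I. \<rho>1 z')
      else real (num_in_state K s z) / (\<Sum>z'\<in>I. real (num_in_state K s z')))"

text \<open>\<open>states\<close> lists all states; it fixes the order in which \<^const>\<open>rounding\<close> visits them.\<close>

definition tie_allocation ::
  "'s list \<Rightarrow> ('s::finite \<Rightarrow> real) \<Rightarrow> ('s \<Rightarrow> real) \<Rightarrow> nat \<Rightarrow> nat \<Rightarrow> (nat \<Rightarrow> 's) \<Rightarrow> 's \<Rightarrow> nat" where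
  "tie_allocation states \<beta> \<rho>1 m K s z =
     (let L = filter (\<lambda>z'. z' \<in> tied_states \<beta> m K s) states;
          amount = m - (\<Sum>z' | \<beta> z' > threshold \<beta> m K s. num_in_state K s z');
          b = rounding amount (map (tie_fraction \<beta> \<rho>1 m K s) L) (map (num_in_state K s) L)
      in the (map_of (zip L b) z))"

definition index_allocation ::
  "'s list \<Rightarrow> ('s::finite \<Rightarrow> real) \<Rightarrow> ('s \<Rightarrow> real) \<Rightarrow> nat \<Rightarrow> nat \<Rightarrow> (nat \<Rightarrow> 's) \<Rightarrow> 's \<Rightarrow> nat" where
  "index_allocation states \<beta> \<rho>1 m K s z =
     (if \<beta> z > threshold \<beta> m K s then num_in_state K s z
      else if z \<in> tied_states \<beta> m K s then tie_allocation states \<beta> \<rho>1 m K s z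
      else 0)"

text \<open>
  The index policy prescribes how many arms in each state are activated. Which of the arms that
  share a state are chosen is left open, so this is a predicate satisfied by every (possibly
  randomized) way of choosing them.
\<close>

definition index_policy ::
  "nat \<Rightarrow> 's kernel \<Rightarrow> 's reward \<Rightarrow> 's list \<Rightarrow> (nat \<Rightarrow> real) \<Rightarrow> ('s::finite \<Rightarrow> bool \<Rightarrow> nat \<Rightarrow> real)
     \<Rightarrow> nat \<Rightarrow> nat \<Rightarrow> (nat \<Rightarrow> 's, nat \<Rightarrow> bool) policy \<Rightarrow> bool" where
  "index_policy T P r states lam \<rho> m K \<pi> \<longleftrightarrow>
     \<pi> \<in> policies K \<and>
     (\<forall>t\<in>{1..T}. \<forall>s. \<forall>a\<in>set_pmf (\<pi> t s). \<forall>z.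
        card {x. x < K \<and> s x = z \<and> a x}
          = index_allocation states (arm_index T P r lam t) (\<lambda>z'. \<rho> z' True t) m K s z)"

end

theory Submission
  imports Defs
begin

text \<open>
  Charging every activation at time \<open>t\<close> the multiplier \<open>lam t\<close> decouples the arms. This bounds the
  total reward of every policy with \<open>m\<close> activations per period by \<open>K * V + m * (\<Sum>t. lam t)\<close>, where
  \<open>V\<close> is the optimal value of a single charged arm (\<open>total_reward_le\<close>). It remains to show that the
  index policy attains this bound up to an error of order \<open>\<surd>K\<close>.

  By linear programming duality, the optimal occupation measure \<open>\<rho>\<close> has charged value \<open>V\<close>
  (\<open>dual_attained\<close>, \<open>occupation_optimal_value\<close>), and therefore only uses actions that are optimal for
  the charged arm (\<open>occupation_optimal_support\<close>). An index is the charge at which the two actions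
  of a state are equally good (\<open>arm_index_eq\<close>), so \<open>\<rho>\<close> activates all its mass in states with index
  above \<open>lam t\<close> and none in states with index below \<open>lam t\<close>. Since \<open>\<rho>\<close> activates the
  fraction \<open>\<alpha>\<close>, the index policy must then activate nearly the numbers of arms
  that \<open>\<rho>\<close> prescribes whenever the numbers of arms in the different states are nearly those
  prescribed by \<open>\<rho>\<close>, with an error that is linear in the deviation (\<open>allocation_stable\<close>); splitting
  ties in proportion to \<open>\<rho>\<close> is what makes this true at the states with index equal to \<open>lam t\<close>.

  Given states and actions, the arms move independently, so the numbers of arms in the states at the
  next time fluctuate by \<open>\<surd>K\<close> around their means (\<open>state_count_deviation\<close>). The deviation from \<open>\<rho>\<close>
  vanishes at time 1 and in expectation grows by at most a constant factor plus a term of order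
  \<open>\<surd>K\<close> per step (\<open>expected_deviation_le\<close>). A backward induction over the horizon, with the remaining
  reward under \<open>\<rho>\<close> minus a multiple of the deviation as potential, turns this into the lower bound
  \<open>K * (V + \<alpha> * (\<Sum>t. lam t)) - C * \<surd>K\<close> for the index policy (\<open>index_policy_reward_ge\<close>).
\<close>


section \<open>Expected rewards of finitely supported controlled chains\<close>

lemma expectation_bind_finite:
  fixes h :: "'b \<Rightarrow> real"
  assumes "finite (set_pmf p)" "\<And>x. x \<in> set_pmf p \<Longrightarrow> finite (set_pmf (f x))"
  shows "measure_pmf.expectation (bind_pmf p f) h
       = measure_pmf.expectation p (\<lambda>x. measure_pmf.expectation (f x) h)"
  using assms
  by (subst pmf_expectation_bind[of "set_pmf p"])
     (auto simp: integral_measure_pmf[of "set_pmf p"])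

lemma expectation_mono_finite:
  fixes f g :: "'a \<Rightarrow> real"
  assumes "finite (set_pmf p)" "\<And>x. x \<in> set_pmf p \<Longrightarrow> f x \<le> g x"
  shows "measure_pmf.expectation p f \<le> measure_pmf.expectation p g"
  using assms by (intro integral_mono_AE integrable_measure_pmf_finite AE_pmfI)

lemma finite_set_run:
  assumes "\<And>t s. finite (set_pmf (\<pi> t s))" "\<And>s a. finite (set_pmf (D s a))"
  shows "finite (set_pmf (run D \<pi> n t s))"
  using assms by (induction n arbitrary: t s) auto

text \<open>Expected total of the rewards \<open>g\<close> collected in the \<open>n\<close> periods from time \<open>t\<close> on.\<close>

definition run_value ::
  "('x \<Rightarrow> 'y \<Rightarrow> 'x pmf) \<Rightarrow> ('x, 'y) policy \<Rightarrow> (nat \<Rightarrow> 'x \<Rightarrow> 'y \<Rightarrow> real) \<Rightarrow> nat \<Rightarrow> nat \<Rightarrow> 'x \<Rightarrow> real" where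
  "run_value D \<pi> g n t s = measure_pmf.expectation (run D \<pi> n t s)
     (\<lambda>h. \<Sum>i<n. g (t + i) (fst (h ! i)) (snd (h ! i)))"

lemma run_value_Suc:
  assumes fin: "\<And>t s. finite (set_pmf (\<pi> t s))" "\<And>s a. finite (set_pmf (D s a))"
  shows "run_value D \<pi> g (Suc n) t s
       = measure_pmf.expectation (\<pi> t s) (\<lambda>a. g t s a +
           measure_pmf.expectation (D s a) (\<lambda>s'. run_value D \<pi> g n (Suc t) s'))"
proof -
  note R = finite_set_run[OF fin]
  show ?thesis
    unfolding run_value_def
    by (simp add: expectation_bind_finite fin R sum.lessThan_Suc_shift integrable_measure_pmf_finite
          del: sum.lessThan_Suc)
qed

text \<open>
  Verification by a potential: if the potential drops at every step at least by the reward
  collected, it dominates the expected total reward.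
\<close>

lemma run_value_le:
  assumes fin: "\<And>t s. finite (set_pmf (\<pi> t s))" "\<And>s a. finite (set_pmf (D s a))"
    and step: "\<And>i s a. t \<le> i \<Longrightarrow> i < t + n \<Longrightarrow> a \<in> set_pmf (\<pi> i s) \<Longrightarrow>
      g i s a + measure_pmf.expectation (D s a) (\<phi> (Suc i)) \<le> \<phi> i s"
    and last: "\<And>s. 0 \<le> \<phi> (t + n) s"
  shows "run_value D \<pi> g n t s \<le> \<phi> t s"
  using step last
proof (induction n arbitrary: t s)
  case 0
  then show ?case by (simp add: run_value_def)
next
  case (Suc n)
  have IH: "run_value D \<pi> g n (Suc t) s' \<le> \<phi> (Suc t) s'" for s'
    by (rule Suc.IH) (use Suc.prems in auto)
  have "run_value D \<pi> g (Suc n) t s \<le> measure_pmf.expectation (\<pi> t s) (\<lambda>_. \<phi> t s)"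
    unfolding run_value_Suc[OF fin]
  proof (rule expectation_mono_finite[OF fin(1)])
    fix a assume a: "a \<in> set_pmf (\<pi> t s)"
    have "measure_pmf.expectation (D s a) (\<lambda>s'. run_value D \<pi> g n (Suc t) s')
        \<le> measure_pmf.expectation (D s a) (\<phi> (Suc t))"
      by (rule expectation_mono_finite[OF fin(2) IH])
    with Suc.prems(1)[of t a s] a
    show "g t s a + measure_pmf.expectation (D s a) (\<lambda>s'. run_value D \<pi> g n (Suc t) s') \<le> \<phi> t s"
      by simp
  qed
  then show ?case by simp
qed

lemma run_value_uminus: "run_value D \<pi> (\<lambda>t s a. - g t s a) n t s = - run_value D \<pi> g n t s"
  by (simp add: run_value_def sum_negf)

lemma run_value_ge:
  assumes fin: "\<And>t s. finite (set_pmf (\<pi> t s))" "\<And>s a. finite (set_pmf (D s a))"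
    and step: "\<And>i s a. t \<le> i \<Longrightarrow> i < t + n \<Longrightarrow> a \<in> set_pmf (\<pi> i s) \<Longrightarrow>
      \<phi> i s \<le> g i s a + measure_pmf.expectation (D s a) (\<phi> (Suc i))"
    and last: "\<And>s. \<phi> (t + n) s \<le> 0"
  shows "\<phi> t s \<le> run_value D \<pi> g n t s"
proof -
  have "run_value D \<pi> (\<lambda>t s a. - g t s a) n t s \<le> - \<phi> t s"
  proof (rule run_value_le[where \<phi> = "\<lambda>t s. - \<phi> t s" and D = D and \<pi> = \<pi>])
    fix i s a assume "t \<le> i" "i < t + n" "a \<in> set_pmf (\<pi> i s)"
    then show "- g i s a + measure_pmf.expectation (D s a) (\<lambda>s'. - \<phi> (Suc i) s') \<le> - \<phi> i s"
      using step[of i a s] by simp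
  qed (use fin last in simp_all)
  then show ?thesis by (simp add: run_value_uminus)
qed


section \<open>The joint chain\<close>

lemma finite_set_Pi_pmf:
  assumes "finite A" "\<And>x. x \<in> A \<Longrightarrow> finite (set_pmf (p x))"
  shows "finite (set_pmf (Pi_pmf A d p))"
  using assms by (auto simp: set_Pi_pmf intro!: finite_PiE_dflt)

lemma finite_set_joint_kernel: "finite (set_pmf (joint_kernel P (s1::'s::finite) K s a))"
  unfolding joint_kernel_def by (rule finite_set_Pi_pmf) auto

lemma finite_set_policy:
  assumes "\<pi> \<in> policies K"
  shows "finite (set_pmf (\<pi> t s))"
proof (rule finite_subset)
  show "set_pmf (\<pi> t s) \<subseteq> PiE_dflt {..<K} False (\<lambda>_. UNIV)"
  proof
    fix a assume "a \<in> set_pmf (\<pi> t s)"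
    moreover have "set_pmf (\<pi> t s) \<subseteq> {a. \<forall>x\<ge>K. \<not> a x}"
      using assms by (simp add: policies_def)
    ultimately have "\<forall>x\<ge>K. \<not> a x" by blast
    then show "a \<in> PiE_dflt {..<K} False (\<lambda>_. UNIV)" by (simp add: PiE_dflt_def)
  qed
  show "finite (PiE_dflt {..<K} False (\<lambda>_. UNIV :: bool set))"
    by (rule finite_PiE_dflt) auto
qed

lemma expectation_component_joint_kernel:
  fixes f :: "'s::finite \<Rightarrow> real"
  assumes "x < K"
  shows "measure_pmf.expectation (joint_kernel P s1 K s a) (\<lambda>s'. f (s' x))
       = (\<Sum>z\<in>UNIV. pmf (P (a x) (s x)) z * f z)"
proof -
  have "measure_pmf.expectation (joint_kernel P s1 K s a) (\<lambda>s'. f (s' x))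
      = measure_pmf.expectation (map_pmf (\<lambda>s'. s' x) (joint_kernel P s1 K s a)) f"
    by simp
  also have "map_pmf (\<lambda>s'. s' x) (joint_kernel P s1 K s a) = P (a x) (s x)"
    using assms unfolding joint_kernel_def by (subst Pi_pmf_component) auto
  also have "measure_pmf.expectation (P (a x) (s x)) f = (\<Sum>z\<in>UNIV. pmf (P (a x) (s x)) z * f z)"
    by (simp add: integral_measure_pmf[of UNIV])
  finally show ?thesis .
qed

lemma sum_from_1: "(\<Sum>t=1..T. f t) = (\<Sum>i<T. f (1 + i))" for f :: "nat \<Rightarrow> real"
  by (rule sum.reindex_bij_witness[of _ "\<lambda>i. 1 + i" "\<lambda>t. t - 1"]) auto

lemma expectation_trajectory:
  "measure_pmf.expectation (trajectory T P s1 K \<pi>) (\<lambda>h. \<Sum>t=1..T. g t (state_at h t) (action_at h t))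
   = run_value (joint_kernel P s1 K) \<pi> g T 1 (\<lambda>_. s1)"
  unfolding run_value_def trajectory_def sum_from_1 by (simp add: state_at_def action_at_def)

lemma total_reward_eq:
  "total_reward T P r s1 K \<pi> = run_value (joint_kernel P s1 K) \<pi> (joint_reward r K) T 1 (\<lambda>_. s1)"
  unfolding total_reward_def by (rule expectation_trajectory)

lemma finite_set_trajectory:
  assumes "\<pi> \<in> policies K"
  shows "finite (set_pmf (trajectory T P (s1::'s::finite) K \<pi>))"
  unfolding trajectory_def using finite_set_run[of \<pi> "joint_kernel P s1 K"]
  by (simp add: finite_set_policy[OF assms] finite_set_joint_kernel)

lemma penalized_reward_eq:
  assumes "\<pi> \<in> policies K"
  shows "total_reward T P r (s1::'s::finite) K \<pi>
       - measure_pmf.expectation (trajectory T P s1 K \<pi>)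
            (\<lambda>h. \<Sum>t=1..T. lam t * (real (num_active K (action_at h t)) - m))
     = run_value (joint_kernel P s1 K) \<pi>
         (\<lambda>t s a. joint_reward r K t s a - lam t * (real (num_active K a) - m)) T 1 (\<lambda>_. s1)"
  unfolding total_reward_def expectation_trajectory[symmetric]
  by (subst Bochner_Integration.integral_diff[symmetric])
     (auto simp: sum_subtractf intro!: integrable_measure_pmf_finite finite_set_trajectory assms)


section \<open>The single-arm problem\<close>

text \<open>The value function, extended by zero after the horizon.\<close>

definition tail_val ::
  "nat \<Rightarrow> 's kernel \<Rightarrow> 's reward \<Rightarrow> (nat \<Rightarrow> real) \<Rightarrow> nat \<Rightarrow> 's::finite \<Rightarrow> real" where
  "tail_val T P r lam t s = (if t \<le> T then val T P r lam t s else 0)"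

lemma tail_val_Suc: "(if t < T then val T P r lam (Suc t) else (\<lambda>_. 0)) = tail_val T P r lam (Suc t)"
  by (auto simp: tail_val_def fun_eq_iff)

lemma val_eq: "val T P r lam t s = (MAX a. action_value P r lam (tail_val T P r lam (Suc t)) s t a)"
  by (subst val.simps) (simp add: tail_val_Suc)

lemma action_value_le_tail_val:
  "t \<le> T \<Longrightarrow> action_value P r lam (tail_val T P r lam (Suc t)) s t a \<le> tail_val T P r lam t s"
  by (simp add: tail_val_def[of T P r lam t] val_eq)

text \<open>An optimal action for the charged arm; ties are resolved in favour of activity.\<close>

definition greedy ::
  "nat \<Rightarrow> 's kernel \<Rightarrow> 's reward \<Rightarrow> (nat \<Rightarrow> real) \<Rightarrow> nat \<Rightarrow> 's::finite \<Rightarrow> bool" where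
  "greedy T P r lam t s \<longleftrightarrow>
     action_value P r lam (tail_val T P r lam (Suc t)) s t False
       \<le> action_value P r lam (tail_val T P r lam (Suc t)) s t True"

lemma action_value_greedy:
  "action_value P r lam (tail_val T P r lam (Suc t)) s t (greedy T P r lam t s) = val T P r lam t s"
  by (auto simp: val_eq greedy_def UNIV_bool max_def)

text \<open>
  The one-step reward of the joint chain, with a continuation that is additive over the arms, is
  additive over the arms as well.
\<close>

lemma joint_step:
  fixes P :: "'s::finite kernel"
  shows "joint_reward r K t s a - lam t * (real (num_active K a) - m)
       + measure_pmf.expectation (joint_kernel P s1 K s a) (\<lambda>s'. (\<Sum>x<K. W (s' x)) + c)
     = (\<Sum>x<K. action_value P r lam W (s x) t (a x)) + (lam t * m + c)"
proof -
  have "measure_pmf.expectation (joint_kernel P s1 K s a) (\<lambda>s'. (\<Sum>x<K. W (s' x)) + c)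
      = (\<Sum>x<K. measure_pmf.expectation (joint_kernel P s1 K s a) (\<lambda>s'. W (s' x))) + c"
    by (simp add: integrable_measure_pmf_finite finite_set_joint_kernel)
  also have "\<dots> = (\<Sum>x<K. \<Sum>z\<in>UNIV. pmf (P (a x) (s x)) z * W z) + c"
    by (simp add: expectation_component_joint_kernel)
  finally show ?thesis
    by (simp add: joint_reward_def num_active_def action_value_def sum.distrib sum_subtractf
        sum_distrib_left algebra_simps)
qed

text \<open>Decoupling: charged for activations, the joint problem splits into independent arms.\<close>

lemma penalized_reward_le:
  fixes P :: "'s::finite kernel"
  assumes \<pi>: "\<pi> \<in> policies K"
  shows "run_value (joint_kernel P s1 K) \<pi>
         (\<lambda>t s a. joint_reward r K t s a - lam t * (real (num_active K a) - m)) T 1 (\<lambda>_. s1)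
       \<le> real K * tail_val T P r lam 1 s1 + m * (\<Sum>t=1..T. lam t)"
proof -
  define \<phi> where "\<phi> t s = (\<Sum>x<K. tail_val T P r lam t (s x)) + m * (\<Sum>i=t..T. lam i)"
    for t and s :: "nat \<Rightarrow> 's"
  have "run_value (joint_kernel P s1 K) \<pi>
         (\<lambda>t s a. joint_reward r K t s a - lam t * (real (num_active K a) - m)) T 1 (\<lambda>_. s1)
        \<le> \<phi> 1 (\<lambda>_. s1)"
  proof (rule run_value_le)
    fix i s a assume i: "1 \<le> i" "i < 1 + T"
    have "(\<Sum>x<K. action_value P r lam (tail_val T P r lam (Suc i)) (s x) i (a x))
        \<le> (\<Sum>x<K. tail_val T P r lam i (s x))"
      by (intro sum_mono action_value_le_tail_val) (use i in auto)
    moreover have "(\<Sum>t=i..T. lam t) = lam i + (\<Sum>t=Suc i..T. lam t)"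
      using i by (simp add: sum.atLeast_Suc_atMost)
    ultimately show "joint_reward r K i s a - lam i * (real (num_active K a) - m)
        + measure_pmf.expectation (joint_kernel P s1 K s a) (\<phi> (Suc i)) \<le> \<phi> i s"
      unfolding \<phi>_def joint_step by (simp add: algebra_simps)
  qed (auto simp: finite_set_policy[OF \<pi>] finite_set_joint_kernel \<phi>_def tail_val_def)
  then show ?thesis by (simp add: \<phi>_def)
qed

lemma penalized_reward_attained:
  fixes P :: "'s::finite kernel"
  shows "\<exists>\<pi>\<in>policies K. real K * tail_val T P r lam 1 s1 + m * (\<Sum>t=1..T. lam t)
     \<le> run_value (joint_kernel P s1 K) \<pi>
         (\<lambda>t s a. joint_reward r K t s a - lam t * (real (num_active K a) - m)) T 1 (\<lambda>_. s1)"
proof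
  define \<pi> :: "(nat \<Rightarrow> 's, nat \<Rightarrow> bool) policy"
    where "\<pi> = (\<lambda>t s. return_pmf (\<lambda>x. x < K \<and> greedy T P r lam t (s x)))"
  show \<pi>: "\<pi> \<in> policies K" by (auto simp: \<pi>_def policies_def)
  define \<phi> where "\<phi> t s = (\<Sum>x<K. tail_val T P r lam t (s x)) + m * (\<Sum>i=t..T. lam i)"
    for t and s :: "nat \<Rightarrow> 's"
  have "\<phi> 1 (\<lambda>_. s1) \<le> run_value (joint_kernel P s1 K) \<pi>
         (\<lambda>t s a. joint_reward r K t s a - lam t * (real (num_active K a) - m)) T 1 (\<lambda>_. s1)"
  proof (rule run_value_ge)
    fix i s a assume i: "1 \<le> i" "i < 1 + T" and a: "a \<in> set_pmf (\<pi> i s)"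
    have "(\<Sum>x<K. action_value P r lam (tail_val T P r lam (Suc i)) (s x) i (a x))
        = (\<Sum>x<K. tail_val T P r lam i (s x))"
      using i a by (intro sum.cong) (auto simp: \<pi>_def action_value_greedy tail_val_def[of _ _ _ _ i])
    moreover have "(\<Sum>t=i..T. lam t) = lam i + (\<Sum>t=Suc i..T. lam t)"
      using i by (simp add: sum.atLeast_Suc_atMost)
    ultimately show "\<phi> i s \<le> joint_reward r K i s a - lam i * (real (num_active K a) - m)
        + measure_pmf.expectation (joint_kernel P s1 K s a) (\<phi> (Suc i))"
      unfolding \<phi>_def joint_step by (simp add: algebra_simps)
  qed (auto simp: finite_set_policy[OF \<pi>] finite_set_joint_kernel \<phi>_def tail_val_def)
  then show "real K * tail_val T P r lam 1 s1 + m * (\<Sum>t=1..T. lam t)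
     \<le> run_value (joint_kernel P s1 K) \<pi>
         (\<lambda>t s a. joint_reward r K t s a - lam t * (real (num_active K a) - m)) T 1 (\<lambda>_. s1)"
    by (simp add: \<phi>_def)
qed

lemma lagrangian_eq:
  fixes P :: "'s::finite kernel"
  shows "lagrangian T P r s1 lam m K = real K * tail_val T P r lam 1 s1 + m * (\<Sum>t=1..T. lam t)"
proof -
  obtain \<pi> where "\<pi> \<in> policies K" "real K * tail_val T P r lam 1 s1 + m * (\<Sum>t=1..T. lam t)
     \<le> run_value (joint_kernel P s1 K) \<pi>
         (\<lambda>t s a. joint_reward r K t s a - lam t * (real (num_active K a) - m)) T 1 (\<lambda>_. s1)"
    using penalized_reward_attained by blast
  then show ?thesis
    unfolding lagrangian_def
    by (intro cSup_eq_maximum) (auto simp: penalized_reward_eq penalized_reward_le simp del: One_nat_def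
        intro!: rev_image_eqI[of \<pi>] antisym)
qed

text \<open>Divided by the number of arms, the Lagrangian no longer depends on that number.\<close>

lemma multiplier_minimizes:
  fixes P :: "'s::finite kernel"
  assumes "1 \<le> K" "lam \<in> multipliers T P r s1 \<alpha> K"
  shows "tail_val T P r lam 1 s1 + \<alpha> * (\<Sum>t=1..T. lam t)
       \<le> tail_val T P r lam' 1 s1 + \<alpha> * (\<Sum>t=1..T. lam' t)"
proof -
  have "real K * (tail_val T P r lam 1 s1 + \<alpha> * (\<Sum>t=1..T. lam t))
      \<le> real K * (tail_val T P r lam' 1 s1 + \<alpha> * (\<Sum>t=1..T. lam' t))"
    using assms(2) by (simp add: multipliers_def lagrangian_eq algebra_simps)
  with assms(1) show ?thesis by simp
qed

text \<open>
  Weak duality: the total charge is the same for all policies with \<open>m\<close> activations per period, so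
  the value of the charged problem bounds their reward.
\<close>

lemma total_reward_le:
  fixes P :: "'s::finite kernel"
  assumes \<pi>: "\<pi> \<in> policies_active T P s1 m K"
  shows "total_reward T P r s1 K \<pi> \<le> real K * tail_val T P r lam 1 s1 + real m * (\<Sum>t=1..T. lam t)"
proof -
  have pol: "\<pi> \<in> policies K" using \<pi> by (simp add: policies_active_def)
  let ?M = "trajectory T P s1 K \<pi>"
  have "AE h in ?M. num_active K (action_at h t) = m" if "t \<in> {1..T}" for t
    using \<pi> that measure_pmf.AE_prob_1[of ?M "{h. num_active K (action_at h t) = m}"]
    by (simp add: policies_active_def)
  then have "num_active K (action_at h t) = m" if "t \<in> {1..T}" "h \<in> set_pmf ?M" for t h
    using that by (simp add: AE_measure_pmf_iff)
  then have "measure_pmf.expectation ?M (\<lambda>h. \<Sum>t=1..T. lam t * (real (num_active K (action_at h t)) - real m))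
      = measure_pmf.expectation ?M (\<lambda>_. 0)"
    by (intro integral_cong_AE AE_pmfI) (auto intro!: sum.neutral)
  then show ?thesis
    using penalized_reward_eq[OF pol, of T P r s1 lam "real m"]
      penalized_reward_le[OF pol, of P s1 r lam "real m" T] by simp
qed


section \<open>Occupation measures and Lagrangian duality\<close>

text \<open>Occupation measures of a single arm whose activity is unconstrained.\<close>

definition flow_measure ::
  "nat \<Rightarrow> 's kernel \<Rightarrow> 's \<Rightarrow> ('s::finite \<Rightarrow> bool \<Rightarrow> nat \<Rightarrow> real) \<Rightarrow> bool" where
  "flow_measure T P s1 \<rho> \<longleftrightarrow>
     (\<forall>t\<in>{2..T}. \<forall>s.
        (\<Sum>a\<in>UNIV. \<rho> s a t) = (\<Sum>a\<in>UNIV. \<Sum>s'\<in>UNIV. \<rho> s' a (t - 1) * pmf (P a s') s)) \<and>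
     (\<forall>s. (\<Sum>a\<in>UNIV. \<rho> s a 1) = of_bool (s = s1)) \<and>
     (\<forall>t\<in>{1..T}. \<forall>s a. 0 \<le> \<rho> s a t)"

lemma occupation_feasible_iff:
  "occupation_feasible T P s1 \<alpha> \<rho> \<longleftrightarrow>
     flow_measure T P s1 \<rho> \<and> (\<forall>t\<in>{1..T}. (\<Sum>s\<in>UNIV. \<rho> s True t) = \<alpha>)"
  by (auto simp: occupation_feasible_def flow_measure_def)

lemma flow_measure_step:
  assumes "flow_measure T P s1 \<rho>" "1 \<le> t" "t < T"
  shows "(\<Sum>a\<in>UNIV. \<rho> s a (Suc t)) = (\<Sum>a\<in>UNIV. \<Sum>s'\<in>UNIV. \<rho> s' a t * pmf (P a s') s)"
proof -
  have "Suc t \<in> {2..T}" using assms by auto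
  then have "(\<Sum>a\<in>UNIV. \<rho> s a (Suc t)) = (\<Sum>a\<in>UNIV. \<Sum>s'\<in>UNIV. \<rho> s' a (Suc t - 1) * pmf (P a s') s)"
    using assms(1) unfolding flow_measure_def by blast
  then show ?thesis by simp
qed

lemma flow_measure_nonneg:
  "flow_measure T P s1 \<rho> \<Longrightarrow> t \<in> {1..T} \<Longrightarrow> 0 \<le> \<rho> s a t"
  unfolding flow_measure_def by blast

lemma flow_measure_init:
  "flow_measure T P s1 \<rho> \<Longrightarrow> (\<Sum>a\<in>UNIV. \<rho> s a 1) = of_bool (s = s1)"
  unfolding flow_measure_def by blast

text \<open>
  The value of an occupation measure falls short of the optimal value by the total
  suboptimality of the actions it uses.
\<close>

lemma occupation_objective_eq:
  assumes flow: "flow_measure T P s1 \<rho>"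
  shows "occupation_objective T r lam \<rho> = tail_val T P r lam 1 s1
    - (\<Sum>t=1..T. \<Sum>a\<in>UNIV. \<Sum>s\<in>UNIV. \<rho> s a t *
         (tail_val T P r lam t s - action_value P r lam (tail_val T P r lam (Suc t)) s t a))"
proof -
  define V where "V = tail_val T P r lam"
  define W where "W t = (\<Sum>a\<in>UNIV. \<Sum>s\<in>UNIV. \<rho> s a t * V t s)" for t
  have step: "(\<Sum>a\<in>UNIV. \<Sum>s\<in>UNIV. \<rho> s a t * (r t s a - lam t * of_bool a))
      = W t - W (Suc t) - (\<Sum>a\<in>UNIV. \<Sum>s\<in>UNIV. \<rho> s a t * (V t s - action_value P r lam (V (Suc t)) s t a))"
    if t: "t \<in> {1..T}" for t
  proof -
    have "W (Suc t) = (\<Sum>s\<in>UNIV. (\<Sum>a\<in>UNIV. \<rho> s a (Suc t)) * V (Suc t) s)"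
      unfolding W_def by (subst sum.swap) (simp add: sum_distrib_right)
    also have "\<dots> = (\<Sum>s\<in>UNIV. (\<Sum>a\<in>UNIV. \<Sum>s'\<in>UNIV. \<rho> s' a t * pmf (P a s') s) * V (Suc t) s)"
    proof (cases "t < T")
      case True
      then show ?thesis using flow_measure_step[OF flow] t by simp
    next
      case False
      then have "V (Suc t) = (\<lambda>_. 0)" by (auto simp: V_def tail_val_def)
      then show ?thesis by simp
    qed
    also have "\<dots> = (\<Sum>s\<in>UNIV. \<Sum>a\<in>UNIV. \<Sum>s'\<in>UNIV. \<rho> s' a t * (pmf (P a s') s * V (Suc t) s))"
      by (simp add: sum_distrib_right mult.assoc)
    also have "\<dots> = (\<Sum>a\<in>UNIV. \<Sum>s\<in>UNIV. \<Sum>s'\<in>UNIV. \<rho> s' a t * (pmf (P a s') s * V (Suc t) s))"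
      by (rule sum.swap)
    also have "\<dots> = (\<Sum>a\<in>UNIV. \<Sum>s'\<in>UNIV. \<Sum>s\<in>UNIV. \<rho> s' a t * (pmf (P a s') s * V (Suc t) s))"
      by (rule sum.cong[OF refl], rule sum.swap)
    finally have W: "W (Suc t) = (\<Sum>a\<in>UNIV. \<Sum>s'\<in>UNIV. \<rho> s' a t * (\<Sum>s\<in>UNIV. pmf (P a s') s * V (Suc t) s))"
      by (simp add: sum_distrib_left)
    show ?thesis
      unfolding W unfolding W_def
      by (simp add: sum_subtractf[symmetric] action_value_def algebra_simps)
  qed
  have "occupation_objective T r lam \<rho> = (\<Sum>t=1..T. W t - W (Suc t))
     - (\<Sum>t=1..T. \<Sum>a\<in>UNIV. \<Sum>s\<in>UNIV. \<rho> s a t * (V t s - action_value P r lam (V (Suc t)) s t a))"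
    unfolding occupation_objective_def sum_subtractf[symmetric]
    using step by (intro sum.cong) (simp_all add: sum_subtractf)
  also have "(\<Sum>t=1..T. W t - W (Suc t)) = W 1 - W (Suc T)"
    unfolding sum_from_1 using sum_lessThan_telescope'[of "\<lambda>i. W (1 + i)" T] by simp
  also have "W (Suc T) = 0"
    by (simp add: W_def V_def tail_val_def)
  also have "W 1 = (\<Sum>s\<in>UNIV. (\<Sum>a\<in>UNIV. \<rho> s a 1) * V 1 s)"
    unfolding W_def by (subst sum.swap) (simp add: sum_distrib_right)
  also have "\<dots> = (\<Sum>s\<in>UNIV. if s = s1 then V 1 s else 0)"
    unfolding flow_measure_init[OF flow] by (intro sum.cong) auto
  also have "\<dots> = V 1 s1"
    by simp
  finally show ?thesis by (simp add: V_def)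
qed

lemma suboptimality_nonneg:
  assumes "flow_measure T P s1 \<rho>" "t \<in> {1..T}"
  shows "0 \<le> \<rho> s a t *
         (tail_val T P r lam t s - action_value P r lam (tail_val T P r lam (Suc t)) s t a)"
  using flow_measure_nonneg[OF assms, of s a] action_value_le_tail_val[of t T P r lam s a] assms(2)
  by simp

lemma occupation_objective_le:
  assumes "flow_measure T P s1 \<rho>"
  shows "occupation_objective T r lam \<rho> \<le> tail_val T P r lam 1 s1"
proof -
  have "0 \<le> (\<Sum>t=1..T. \<Sum>a\<in>UNIV. \<Sum>s\<in>UNIV. \<rho> s a t *
         (tail_val T P r lam t s - action_value P r lam (tail_val T P r lam (Suc t)) s t a))"
    by (intro sum_nonneg suboptimality_nonneg[OF assms])
  then show ?thesis unfolding occupation_objective_eq[OF assms] by simp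
qed

text \<open>Law of the state at time \<open>n + 1\<close> of an arm which follows the deterministic policy \<open>d\<close>.\<close>

primrec state_law :: "'s kernel \<Rightarrow> 's \<Rightarrow> (nat \<Rightarrow> 's \<Rightarrow> bool) \<Rightarrow> nat \<Rightarrow> 's::finite \<Rightarrow> real" where
  "state_law P s1 d 0 s = of_bool (s = s1)"
| "state_law P s1 d (Suc n) s =
     (\<Sum>s'\<in>UNIV. state_law P s1 d n s' * pmf (P (d (Suc n) s') s') s)"

lemma state_law_nonneg: "0 \<le> state_law P s1 d n s"
  by (induction n arbitrary: s) (auto intro!: sum_nonneg)

lemma sum_state_law: "(\<Sum>s\<in>UNIV. state_law P s1 d n s) = 1"
proof (induction n)
  case 0
  then show ?case by (simp add: of_bool_def)
next
  case (Suc n)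
  have "(\<Sum>s\<in>UNIV. state_law P s1 d (Suc n) s)
      = (\<Sum>s'\<in>UNIV. state_law P s1 d n s' * (\<Sum>s\<in>UNIV. pmf (P (d (Suc n) s') s') s))"
    by (simp add: sum_distrib_left) (rule sum.swap)
  then show ?case using Suc by (simp add: sum_pmf_eq_1)
qed

lemma state_law_le_1: "state_law P s1 d n s \<le> 1"
  using member_le_sum[of s UNIV "state_law P s1 d n"] state_law_nonneg[of P s1 d n]
  by (simp add: sum_state_law)

lemma greedy_flow_measure:
  fixes P :: "'s::finite kernel"
  obtains \<rho> where "flow_measure T P s1 \<rho>" "\<And>s a t. 0 \<le> \<rho> s a t \<and> \<rho> s a t \<le> 1"
    "occupation_objective T r lam \<rho> = tail_val T P r lam 1 s1"
proof
  define d where "d = greedy T P r lam"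
  define \<rho> where "\<rho> s a t = state_law P s1 d (t - 1) s * of_bool (a = d t s)" for s a t
  have marginal: "(\<Sum>a\<in>UNIV. \<rho> s a t) = state_law P s1 d (t - 1) s" for s t
    by (cases "d t s") (auto simp: \<rho>_def UNIV_bool)
  show flow: "flow_measure T P s1 \<rho>"
    unfolding flow_measure_def marginal
  proof (intro conjI ballI allI)
    fix t s assume "t \<in> {2..T}"
    then have "t = Suc (Suc (t - 2))" by auto
    then obtain n where t: "t = Suc (Suc n)" by blast
    have "(\<Sum>a\<in>UNIV. \<Sum>s'\<in>UNIV. \<rho> s' a (t - 1) * pmf (P a s') s)
        = (\<Sum>s'\<in>UNIV. \<Sum>a\<in>UNIV. \<rho> s' a (t - 1) * pmf (P a s') s)"
      by (rule sum.swap)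
    also have "\<dots> = state_law P s1 d (t - 1) s"
      unfolding t by (auto simp: \<rho>_def UNIV_bool intro!: sum.cong)
    finally show "state_law P s1 d (t - 1) s
        = (\<Sum>a\<in>UNIV. \<Sum>s'\<in>UNIV. \<rho> s' a (t - 1) * pmf (P a s') s)" ..
  qed (simp_all add: \<rho>_def state_law_nonneg)
  show "0 \<le> \<rho> s a t \<and> \<rho> s a t \<le> 1" for s a t
    by (auto simp: \<rho>_def state_law_nonneg state_law_le_1)
  have "\<rho> s a t * (tail_val T P r lam t s - action_value P r lam (tail_val T P r lam (Suc t)) s t a) = 0"
    if "t \<in> {1..T}" for s a t
  proof (cases "a = d t s")
    case True
    have "tail_val T P r lam t s = val T P r lam t s" using that by (simp add: tail_val_def)
    then show ?thesis unfolding True d_def by (simp add: action_value_greedy)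
  qed (simp add: \<rho>_def)
  then show "occupation_objective T r lam \<rho> = tail_val T P r lam 1 s1"
    unfolding occupation_objective_eq[OF flow] by (subst sum.neutral) (auto intro!: sum.neutral simp del: mult_eq_0_iff)
qed

lemma occupation_objective_shift:
  "occupation_objective T r (\<lambda>t. lam t + d t) \<rho>
   = occupation_objective T r lam \<rho> - (\<Sum>t=1..T. d t * (\<Sum>s\<in>UNIV. \<rho> s True t))"
proof -
  have "(\<Sum>s\<in>UNIV. \<rho> s a t * (r t s a - (lam t + d t) * of_bool a))
      = (\<Sum>s\<in>UNIV. \<rho> s a t * (r t s a - lam t * of_bool a))
        - d t * of_bool a * (\<Sum>s\<in>UNIV. \<rho> s a t)" for t a
    unfolding sum_distrib_left sum_subtractf[symmetric]
    by (rule sum.cong) (simp_all add: algebra_simps)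
  then have "(\<Sum>a\<in>UNIV. \<Sum>s\<in>UNIV. \<rho> s a t * (r t s a - (lam t + d t) * of_bool a))
      = (\<Sum>a\<in>UNIV. \<Sum>s\<in>UNIV. \<rho> s a t * (r t s a - lam t * of_bool a))
        - d t * (\<Sum>s\<in>UNIV. \<rho> s True t)" for t
    by (simp add: UNIV_bool)
  then show ?thesis by (simp add: occupation_objective_def sum_subtractf)
qed

lemma nonpos_if_le_all_multiples:
  fixes a b :: real
  assumes "\<And>\<theta>. 0 < \<theta> \<Longrightarrow> \<theta> \<le> 1 \<Longrightarrow> a \<le> \<theta> * b"
  shows "a \<le> 0"
proof (rule tendsto_lowerbound)
  show "((\<lambda>\<theta>. \<theta> * b) \<longlongrightarrow> 0) (at_right 0)" by (auto intro!: tendsto_eq_intros)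
  show "\<forall>\<^sub>F \<theta> in at_right 0. a \<le> \<theta> * b"
    unfolding eventually_at_right_field using assms by (intro exI[of _ 1]) auto
qed simp

text \<open>
  If the multiplier minimizes the dual function, some occupation measure with activity \<open>\<alpha>\<close> at all
  times attains the optimal value of the charged problem. It is found as the maximizer of the
  charged reward minus half the squared violation \<open>g\<close> of the activity constraint: by the first-order
  condition, it also maximizes the reward charged at \<open>lam + g\<close>, where the dual function would be
  smaller by \<open>|g|\<^sup>2\<close>; hence \<open>g = 0\<close>.
\<close>

lemma dual_attained:
  fixes P :: "'s::finite kernel"
  assumes min: "\<And>lam'. tail_val T P r lam 1 s1 + \<alpha> * (\<Sum>t=1..T. lam t)
       \<le> tail_val T P r lam' 1 s1 + \<alpha> * (\<Sum>t=1..T. lam' t)"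
  obtains \<rho> where "occupation_feasible T P s1 \<alpha> \<rho>"
    "tail_val T P r lam 1 s1 \<le> occupation_objective T r lam \<rho>"
proof -
  \<comment> \<open>Uncurried measures live in a product of intervals, which is compact.\<close>
  define cur where "cur x = (\<lambda>s a t. x (s, a, t))" for x :: "'s \<times> bool \<times> nat \<Rightarrow> real"
  define B where "B = (PiE UNIV (\<lambda>_. {0..1}) :: ('s \<times> bool \<times> nat \<Rightarrow> real) set)"
  define M where "M = B \<inter> {x. flow_measure T P s1 (cur x)}"
  define J where "J x = occupation_objective T r lam (cur x)" for x
  define g where "g x t = (\<Sum>s\<in>UNIV. cur x s True t) - \<alpha>" for x and t :: nat
  note coord = continuous_on_product_coordinates
  have "compact B"
    unfolding B_def using compactin_PiE[of "\<lambda>_. euclidean" UNIV "\<lambda>_::'s \<times> bool \<times> nat. {0..1::real}"]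
    by (simp add: euclidean_product_topology)
  moreover have "closed {x. flow_measure T P s1 (cur x)}"
    unfolding flow_measure_def cur_def Collect_conj_eq Collect_ball_eq Collect_all_eq
    by (intro closed_Int closed_INT ballI closed_Collect_eq closed_Collect_le
        continuous_on_sum continuous_on_mult continuous_on_const coord)
  ultimately have "compact M"
    unfolding M_def by (rule compact_Int_closed)
  moreover have "\<exists>x\<in>M. occupation_objective T r lam' (cur x) = tail_val T P r lam' 1 s1" for lam'
  proof -
    obtain \<rho> where "flow_measure T P s1 \<rho>" "\<And>s a t. 0 \<le> \<rho> s a t \<and> \<rho> s a t \<le> 1"
      "occupation_objective T r lam' \<rho> = tail_val T P r lam' 1 s1"
      using greedy_flow_measure by blast
    then show ?thesis
      by (intro bexI[of _ "\<lambda>(s, a, t). \<rho> s a t"]) (auto simp: M_def B_def cur_def)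
  qed
  note attained = this
  moreover have "continuous_on M (\<lambda>x. J x - (\<Sum>t=1..T. (g x t)\<^sup>2) / 2)"
    unfolding J_def g_def occupation_objective_def cur_def
    by (rule continuous_on_subset[of UNIV])
       (intro continuous_intros coord, auto)
  ultimately obtain x where x: "x \<in> M"
    and max: "\<And>y. y \<in> M \<Longrightarrow> J y - (\<Sum>t=1..T. (g y t)\<^sup>2) / 2 \<le> J x - (\<Sum>t=1..T. (g x t)\<^sup>2) / 2"
    using continuous_attains_sup[of M "\<lambda>x. J x - (\<Sum>t=1..T. (g x t)\<^sup>2) / 2"] by blast
  have first_order: "J y - J x \<le> (\<Sum>t=1..T. g x t * (g y t - g x t))" if y: "y \<in> M" for y
  proof -
    have "J y - J x - (\<Sum>t=1..T. g x t * (g y t - g x t)) \<le> \<theta> * ((\<Sum>t=1..T. (g y t - g x t)\<^sup>2) / 2)"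
      if \<theta>: "0 < \<theta>" "\<theta> \<le> 1" for \<theta>
    proof -
      define z where "z = (\<lambda>i. (1 - \<theta>) * x i + \<theta> * y i)"
      have lin: "(\<Sum>i\<in>I. (1 - \<theta>) * u i + \<theta> * v i) = (1 - \<theta>) * (\<Sum>i\<in>I. u i) + \<theta> * (\<Sum>i\<in>I. v i)"
        for u v :: "'i \<Rightarrow> real" and I
        by (simp add: sum.distrib sum_distrib_left)
      have lin2: "((1 - \<theta>) * u + \<theta> * v) * c = (1 - \<theta>) * (u * c) + \<theta> * (v * c)" for u v c :: real
        by (simp add: algebra_simps)
      have "z \<in> M"
        unfolding M_def
      proof
        have box: "0 \<le> u i \<and> u i \<le> 1" if "u \<in> M" for u i
          using that by (simp add: M_def B_def PiE_iff del: split_paired_All)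
        have "0 \<le> z i \<and> z i \<le> 1" for i
        proof -
          have "z i \<le> (1 - \<theta>) * 1 + \<theta> * 1" unfolding z_def
            using box[OF x, of i] box[OF y, of i] \<theta> by (intro add_mono mult_left_mono) auto
          moreover have "0 \<le> z i"
            using box[OF x, of i] box[OF y, of i] \<theta> by (simp add: z_def)
          ultimately show ?thesis by simp
        qed
        then show "z \<in> B" by (simp add: B_def PiE_iff)
        have fx: "flow_measure T P s1 (cur x)" and fy: "flow_measure T P s1 (cur y)"
          using x y by (simp_all add: M_def)
        have "flow_measure T P s1 (cur z)"
          unfolding flow_measure_def
        proof (intro conjI ballI allI)
          fix t s assume t: "t \<in> {2..T}"
          have "(\<Sum>a\<in>UNIV. cur x s a t) = (\<Sum>a\<in>UNIV. \<Sum>s'\<in>UNIV. cur x s' a (t - 1) * pmf (P a s') s)"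
            and "(\<Sum>a\<in>UNIV. cur y s a t) = (\<Sum>a\<in>UNIV. \<Sum>s'\<in>UNIV. cur y s' a (t - 1) * pmf (P a s') s)"
            using fx fy t unfolding flow_measure_def by blast+
          then show "(\<Sum>a\<in>UNIV. cur z s a t) = (\<Sum>a\<in>UNIV. \<Sum>s'\<in>UNIV. cur z s' a (t - 1) * pmf (P a s') s)"
            unfolding cur_def z_def lin lin2 by metis
        next
          fix s
          show "(\<Sum>a\<in>UNIV. cur z s a 1) = of_bool (s = s1)"
            using flow_measure_init[OF fx, of s] flow_measure_init[OF fy, of s]
            unfolding cur_def z_def lin by simp
        next
          fix t s a assume t: "t \<in> {1..T}"
          show "0 \<le> cur z s a t"
            using flow_measure_nonneg[OF fx t, of s a] flow_measure_nonneg[OF fy t, of s a] \<theta>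
            by (simp add: cur_def z_def)
        qed
        then show "z \<in> {x. flow_measure T P s1 (cur x)}" by simp
      qed
      moreover have "J z = (1 - \<theta>) * J x + \<theta> * J y"
        unfolding J_def occupation_objective_def cur_def z_def by (simp add: lin lin2)
      moreover have "g z t = g x t + \<theta> * (g y t - g x t)" for t
        unfolding g_def cur_def z_def by (simp add: lin) (simp add: algebra_simps)
      ultimately have "(1 - \<theta>) * J x + \<theta> * J y - (\<Sum>t=1..T. (g x t + \<theta> * (g y t - g x t))\<^sup>2) / 2
          \<le> J x - (\<Sum>t=1..T. (g x t)\<^sup>2) / 2"
        using max[of z] by simp
      moreover have "(\<Sum>t=1..T. (g x t + \<theta> * (g y t - g x t))\<^sup>2)
          = (\<Sum>t=1..T. (g x t)\<^sup>2) + 2 * \<theta> * (\<Sum>t=1..T. g x t * (g y t - g x t))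
            + \<theta> * \<theta> * (\<Sum>t=1..T. (g y t - g x t)\<^sup>2)"
        unfolding sum_distrib_left sum.distrib[symmetric]
        by (rule sum.cong) (simp_all add: power2_eq_square algebra_simps)
      moreover have "(1 - \<theta>) * j + \<theta> * j' - v / 2 \<le> j - u / 2 \<Longrightarrow> v = u + 2 * \<theta> * c + \<theta> * \<theta> * d
          \<Longrightarrow> \<theta> * (j' - j - c) \<le> \<theta> * (\<theta> * (d / 2))" for j j' u v c d :: real
        by (simp add: field_simps)
      ultimately have "\<theta> * (J y - J x - (\<Sum>t=1..T. g x t * (g y t - g x t)))
          \<le> \<theta> * (\<theta> * ((\<Sum>t=1..T. (g y t - g x t)\<^sup>2) / 2))"
        by blast
      with \<theta> show ?thesis by simp
    qed
    then have "J y - J x - (\<Sum>t=1..T. g x t * (g y t - g x t)) \<le> 0"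
      by (rule nonpos_if_le_all_multiples)
    then show ?thesis by simp
  qed
  define lam' where "lam' = (\<lambda>t. lam t + g x t)"
  obtain y where y: "y \<in> M" and Jy: "occupation_objective T r lam' (cur y) = tail_val T P r lam' 1 s1"
    using attained by blast
  have "tail_val T P r lam' 1 s1 = occupation_objective T r lam' (cur y)"
    by (simp only: Jy)
  also have "\<dots> = J y - (\<Sum>t=1..T. g x t * (g y t + \<alpha>))"
    unfolding lam'_def occupation_objective_shift by (simp add: J_def g_def)
  also have "\<dots> = J y - (\<Sum>t=1..T. g x t * (g y t - g x t)) - (\<Sum>t=1..T. (g x t)\<^sup>2) - \<alpha> * (\<Sum>t=1..T. g x t)"
  proof -
    have "(\<Sum>t=1..T. g x t * (g y t + \<alpha>))
        = (\<Sum>t=1..T. g x t * (g y t - g x t)) + (\<Sum>t=1..T. (g x t)\<^sup>2) + \<alpha> * (\<Sum>t=1..T. g x t)"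
      unfolding sum_distrib_left sum.distrib[symmetric]
      by (rule sum.cong) (simp_all add: power2_eq_square algebra_simps)
    then show ?thesis by simp
  qed
  also have "\<dots> \<le> J x - (\<Sum>t=1..T. (g x t)\<^sup>2) - \<alpha> * (\<Sum>t=1..T. g x t)"
    using first_order[OF y] by simp
  finally have "tail_val T P r lam' 1 s1 \<le> J x - (\<Sum>t=1..T. (g x t)\<^sup>2) - \<alpha> * (\<Sum>t=1..T. g x t)" .
  moreover have "tail_val T P r lam 1 s1 + \<alpha> * (\<Sum>t=1..T. lam t)
      \<le> tail_val T P r lam' 1 s1 + \<alpha> * (\<Sum>t=1..T. lam t) + \<alpha> * (\<Sum>t=1..T. g x t)"
    using min[of lam'] by (simp add: lam'_def sum.distrib algebra_simps)
  ultimately have le: "tail_val T P r lam 1 s1 + (\<Sum>t=1..T. (g x t)\<^sup>2) \<le> J x"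
    by simp
  have flow: "flow_measure T P s1 (cur x)" using x by (simp add: M_def)
  have "J x \<le> tail_val T P r lam 1 s1"
    unfolding J_def by (rule occupation_objective_le[OF flow])
  with le have "(\<Sum>t=1..T. (g x t)\<^sup>2) \<le> 0" by simp
  then have "(\<Sum>t=1..T. (g x t)\<^sup>2) = 0" by (intro antisym sum_nonneg) auto
  then have "\<forall>t\<in>{1..T}. g x t = 0" by (subst (asm) sum_nonneg_eq_0_iff) auto
  then have "occupation_feasible T P s1 \<alpha> (cur x)"
    using flow by (auto simp: occupation_feasible_iff g_def)
  moreover have "tail_val T P r lam 1 s1 \<le> occupation_objective T r lam (cur x)"
    using le sum_nonneg[of "{1..T}" "\<lambda>t. (g x t)\<^sup>2"] by (simp add: J_def)
  ultimately show ?thesis by (rule that)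
qed

lemma occupation_optimal_value:
  fixes P :: "'s::finite kernel"
  assumes min: "\<And>lam'. tail_val T P r lam 1 s1 + \<alpha> * (\<Sum>t=1..T. lam t)
       \<le> tail_val T P r lam' 1 s1 + \<alpha> * (\<Sum>t=1..T. lam' t)"
    and opt: "occupation_optimal T P r s1 \<alpha> lam \<rho>"
  shows "occupation_objective T r lam \<rho> = tail_val T P r lam 1 s1"
proof (rule antisym)
  show "occupation_objective T r lam \<rho> \<le> tail_val T P r lam 1 s1"
    using opt by (intro occupation_objective_le) (simp add: occupation_optimal_def occupation_feasible_iff)
  obtain \<rho>' where "occupation_feasible T P s1 \<alpha> \<rho>'"
    "tail_val T P r lam 1 s1 \<le> occupation_objective T r lam \<rho>'"
    using dual_attained[OF min] .
  then show "tail_val T P r lam 1 s1 \<le> occupation_objective T r lam \<rho>"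
    using opt by (force simp: occupation_optimal_def)
qed

text \<open>
  Complementary slackness: an optimal occupation measure only uses actions that are optimal for the
  charged arm.
\<close>

lemma occupation_optimal_support:
  fixes P :: "'s::finite kernel"
  assumes min: "\<And>lam'. tail_val T P r lam 1 s1 + \<alpha> * (\<Sum>t=1..T. lam t)
       \<le> tail_val T P r lam' 1 s1 + \<alpha> * (\<Sum>t=1..T. lam' t)"
    and opt: "occupation_optimal T P r s1 \<alpha> lam \<rho>"
    and t: "t \<in> {1..T}" and pos: "\<rho> s a t \<noteq> 0"
  shows "action_value P r lam (tail_val T P r lam (Suc t)) s t b
       \<le> action_value P r lam (tail_val T P r lam (Suc t)) s t a"
proof -
  have flow: "flow_measure T P s1 \<rho>"
    using opt by (simp add: occupation_optimal_def occupation_feasible_iff)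
  let ?gap = "\<lambda>s a t. \<rho> s a t *
     (tail_val T P r lam t s - action_value P r lam (tail_val T P r lam (Suc t)) s t a)"
  have nn: "t \<in> {1..T} \<Longrightarrow> 0 \<le> ?gap s a t" for s a t
    by (rule suboptimality_nonneg[OF flow])
  have "(\<Sum>t=1..T. \<Sum>a\<in>UNIV. \<Sum>s\<in>UNIV. ?gap s a t) = 0"
    using occupation_objective_eq[OF flow, of r lam] occupation_optimal_value[OF min opt] by simp
  then have "\<forall>t\<in>{1..T}. (\<Sum>a\<in>UNIV. \<Sum>s\<in>UNIV. ?gap s a t) = 0"
    by (subst (asm) sum_nonneg_eq_0_iff) (intro sum_nonneg nn finite_atLeastAtMost)+
  then have "(\<Sum>a\<in>UNIV. \<Sum>s\<in>UNIV. ?gap s a t) = 0" using t by blast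
  then have "\<forall>a\<in>UNIV. (\<Sum>s\<in>UNIV. ?gap s a t) = 0"
    by (subst (asm) sum_nonneg_eq_0_iff) (intro sum_nonneg nn[OF t] finite)+
  then have "(\<Sum>s\<in>UNIV. ?gap s a t) = 0" by blast
  then have "\<forall>s\<in>UNIV. ?gap s a t = 0"
    by (subst (asm) sum_nonneg_eq_0_iff) (intro nn[OF t] finite)+
  then have "?gap s a t = 0" by blast
  with pos have "tail_val T P r lam t s = action_value P r lam (tail_val T P r lam (Suc t)) s t a"
    by simp
  then show ?thesis using action_value_le_tail_val[of t T P r lam s b] t by simp
qed


section \<open>Indices\<close>

lemma tail_val_upd:
  "t0 < t \<Longrightarrow> tail_val T P r (lam(t0 := \<beta>)) t = tail_val T P r lam t"
proof (induction "Suc T - t" arbitrary: t)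
  case 0
  then show ?case by (auto simp: tail_val_def)
next
  case (Suc k)
  have IH: "tail_val T P r (lam(t0 := \<beta>)) (Suc t) = tail_val T P r lam (Suc t)"
    by (rule Suc.hyps(1)) (use Suc in auto)
  have "action_value P r (lam(t0 := \<beta>)) W s t a = action_value P r lam W s t a" for W s a
    using Suc.prems by (simp add: action_value_def)
  then show ?case
    using Suc.hyps(2) by (simp add: tail_val_def[of T P r _ t] val_eq IH fun_eq_iff)
qed

text \<open>
  The index is the charge at which the two actions are equally good: the continuation values do not
  depend on the current charge, so the advantage of activity decreases linearly in it.
\<close>

lemma arm_index_eq:
  fixes P :: "'s::finite kernel"
  assumes t: "t \<in> {1..T}"
  shows "arm_index T P r lam t s = lam t
    + action_value P r lam (tail_val T P r lam (Suc t)) s t True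
    - action_value P r lam (tail_val T P r lam (Suc t)) s t False"
    (is "_ = ?c")
proof -
  let ?V = "tail_val T P r lam (Suc t)"
  have av: "action_value P r (lam(t := \<beta>)) ?V s t a
      = action_value P r lam ?V s t a + of_bool a * (lam t - \<beta>)" for \<beta> a
    by (simp add: action_value_def algebra_simps)
  have tail: "tail_val T P r (lam(t := \<beta>)) (Suc t) = ?V" for \<beta>
    by (rule tail_val_upd) simp
  have "{\<beta>. \<exists>\<pi>\<in>optimal_policies T P r (lam(t := \<beta>)). pmf (\<pi> t s) True = 1} = {..?c}"
  proof (intro equalityI subsetI CollectI)
    fix \<beta> assume "\<beta> \<in> {\<beta>. \<exists>\<pi>\<in>optimal_policies T P r (lam(t := \<beta>)). pmf (\<pi> t s) True = 1}"
    then obtain \<pi> where \<pi>: "\<pi> \<in> optimal_policies T P r (lam(t := \<beta>))" "pmf (\<pi> t s) True = 1"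
      by blast
    have "\<exists>a. \<pi> t s = return_pmf a \<and> action_value P r (lam(t := \<beta>))
        (tail_val T P r (lam(t := \<beta>)) (Suc t)) s t a = val T P r (lam(t := \<beta>)) t s"
      using \<pi>(1) t unfolding optimal_policies_def tail_val_Suc by blast
    then obtain a where a: "\<pi> t s = return_pmf a"
      "action_value P r (lam(t := \<beta>)) ?V s t a = val T P r (lam(t := \<beta>)) t s"
      unfolding tail by blast
    have "a = True" using \<pi>(2) a(1) by (cases a) auto
    moreover have "action_value P r (lam(t := \<beta>)) ?V s t False \<le> val T P r (lam(t := \<beta>)) t s"
      unfolding val_eq tail by simp
    ultimately show "\<beta> \<in> {..?c}" using a(2) by (simp add: av)
  next
    fix \<beta> assume "\<beta> \<in> {..?c}"
    then have gr: "greedy T P r (lam(t := \<beta>)) t s"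
      by (simp add: greedy_def tail av)
    define \<pi> where "\<pi> = (\<lambda>t' s'. return_pmf (greedy T P r (lam(t := \<beta>)) t' s'))"
    have "\<pi> \<in> optimal_policies T P r (lam(t := \<beta>))"
      unfolding optimal_policies_def tail_val_Suc \<pi>_def by (simp add: action_value_greedy)
    moreover have "pmf (\<pi> t s) True = 1" using gr by (simp add: \<pi>_def)
    ultimately show "\<exists>\<pi>\<in>optimal_policies T P r (lam(t := \<beta>)). pmf (\<pi> t s) True = 1"
      by blast
  qed
  then show ?thesis unfolding arm_index_def by simp
qed


section \<open>Rounding\<close>

text \<open>
  The loop increases some entry within each round of the pointer, because the entries can still be
  increased as long as their sum is below \<open>amount\<close>. It thus terminates with entries that add up to
  \<open>amount\<close> and are at least the initial ones.
\<close>

lemma rounding_spec: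
  assumes len: "length fracs = length avail" and le: "amount \<le> sum_list avail"
    and nonneg: "\<And>f. f \<in> set fracs \<Longrightarrow> 0 \<le> f" and sum1: "sum_list fracs = 1"
  shows "length (rounding amount fracs avail) = length avail
       \<and> sum_list (rounding amount fracs avail) = amount
       \<and> (\<forall>i<length avail. min (avail ! i) (nat \<lfloor>real amount * fracs ! i\<rfloor>) \<le> rounding amount fracs avail ! i
            \<and> rounding amount fracs avail ! i \<le> avail ! i)"
proof -
  define n where "n = length avail"
  define init where "init = map2 (\<lambda>v f. min v (nat \<lfloor>real amount * f\<rfloor>)) avail fracs"
  define Inv where "Inv = (\<lambda>(b, j). length b = n \<and> j < n \<and> sum_list b \<le> amount
      \<and> (\<forall>i<n. init ! i \<le> b ! i \<and> b ! i \<le> avail ! i))"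
  define goes where "goes = (\<lambda>(b::nat list, j::nat). sum_list b < amount)"
  define step where "step = (\<lambda>(b, j). (b[j := b ! j + of_bool (avail ! j > b ! j)], (j + 1) mod length avail))"
  define wait where "wait = (\<lambda>(b, j). LEAST d. b ! ((j + d) mod n) < avail ! ((j + d) mod n))"
  have n: "0 < n" using sum1 len by (cases avail) (auto simp: n_def)
  have init_nth: "init ! i = min (avail ! i) (nat \<lfloor>real amount * fracs ! i\<rfloor>)" if "i < n" for i
    using that len by (simp add: init_def n_def)
  have init_len: "length init = n" using len by (simp add: init_def n_def)
  have "real (sum_list init) = (\<Sum>i=0..<n. real (init ! i))"
    by (simp add: sum_list_sum_nth init_len)
  also have "\<dots> \<le> (\<Sum>i=0..<n. real amount * fracs ! i)"
  proof (rule sum_mono)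
    fix i assume i: "i \<in> {0..<n}"
    then have "0 \<le> fracs ! i" using nonneg len by (simp add: n_def)
    then have "real (nat \<lfloor>real amount * fracs ! i\<rfloor>) \<le> real amount * fracs ! i" by simp
    then show "real (init ! i) \<le> real amount * fracs ! i" using i by (simp add: init_nth min_def)
  qed
  also have "\<dots> = real amount"
    using sum1 len by (simp add: sum_distrib_left[symmetric] sum_list_sum_nth n_def)
  finally have Inv_init: "Inv (init, 0)"
    using n by (simp add: Inv_def init_len init_nth)
  have "Inv (while goes step (init, 0)) \<and> \<not> goes (while goes step (init, 0))"
  proof (rule while_rule2[where P = Inv and r = "measures [\<lambda>(b, j). amount - sum_list b, wait]"])
    fix x assume "Inv x" "goes x"
    moreover obtain b j where x: "x = (b, j)" by (cases x)
    ultimately have lb: "length b = n" and j: "j < n" and lt: "sum_list b < amount"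
      and b: "\<And>i. i < n \<Longrightarrow> init ! i \<le> b ! i" "\<And>i. i < n \<Longrightarrow> b ! i \<le> avail ! i"
      by (auto simp: Inv_def goes_def)
    show "Inv (step x) \<and> (step x, x) \<in> measures [\<lambda>(b, j). amount - sum_list b, wait]"
    proof (cases "b ! j < avail ! j")
      case True
      have "sum_list (b[j := b ! j + 1]) = sum_list b + 1"
        using j lb by (simp add: sum_list_update)
      then show ?thesis
        using True x lb j lt b n by (auto simp: Inv_def step_def n_def nth_list_update intro: le_SucI)
    next
      case False
      \<comment> \<open>Some entry is not yet full, and the pointer comes one step closer to the next such entry.\<close>
      have st: "step x = (b, (j + 1) mod n)" using False x by (simp add: step_def n_def)
      have "\<exists>i<n. b ! i < avail ! i"
      proof (rule ccontr)
        assume "\<not> ?thesis"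
        then have "avail ! i \<le> b ! i" if "i < n" for i using that by (meson not_less)
        then have "(\<Sum>i=0..<n. avail ! i) \<le> (\<Sum>i=0..<n. b ! i)" by (intro sum_mono) simp
        then show False using lt le lb by (simp add: sum_list_sum_nth n_def)
      qed
      then obtain i where i: "i < n" "b ! i < avail ! i" by blast
      let ?Q = "\<lambda>d. b ! ((j + d) mod n) < avail ! ((j + d) mod n)"
      have "?Q (n + i - j)" using i j by simp
      then have Q: "?Q (wait x)" unfolding wait_def x by (auto intro: LeastI)
      then have "wait x \<noteq> 0" using False j by (metis add.right_neutral mod_less)
      then obtain d where d: "wait x = Suc d" by (cases "wait x") auto
      have eq: "((j + 1) mod n + d) mod n = (j + wait x) mod n" by (simp add: d mod_simps)
      have "b ! (((j + 1) mod n + d) mod n) < avail ! (((j + 1) mod n + d) mod n)"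
        unfolding eq by (rule Q)
      then have "wait (step x) \<le> d"
        unfolding st wait_def prod.case by (rule Least_le)
      then show ?thesis
        using x lb j lt b n st d by (simp add: Inv_def)
    qed
  qed (use Inv_init in auto)
  moreover have "rounding amount fracs avail = fst (while goes step (init, 0))"
    unfolding rounding_def goes_def step_def init_def ..
  ultimately show ?thesis
    by (cases "while goes step (init, 0)") (auto simp: Inv_def goes_def n_def[symmetric] init_nth)
qed


section \<open>The allocation prescribed by the index policy\<close>

lemma sum_num_in_state:
  fixes s :: "nat \<Rightarrow> 's::finite"
  shows "(\<Sum>z\<in>A. num_in_state K s z) = card {x. x < K \<and> s x \<in> A}"
proof -
  have "card {x. x < K \<and> s x \<in> A} = card (\<Union>z\<in>A. {x. x < K \<and> s x = z})"
    by (rule arg_cong[of _ _ card]) auto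
  also have "\<dots> = (\<Sum>z\<in>A. card {x. x < K \<and> s x = z})"
    by (rule card_UN_disjoint) auto
  finally show ?thesis by (simp add: num_in_state_def)
qed

text \<open>
  The threshold is the \<open>m\<close>-th largest index of the arms: fewer than \<open>m\<close> arms have a larger index, and
  at least \<open>m\<close> arms have an index that is at least as large.
\<close>

lemma threshold_counts:
  fixes s :: "nat \<Rightarrow> 's::finite"
  assumes m: "1 \<le> m" "m \<le> K"
  shows "(\<Sum>z | threshold \<beta> m K s < \<beta> z. num_in_state K s z) < m"
    and "m \<le> (\<Sum>z | threshold \<beta> m K s \<le> \<beta> z. num_in_state K s z)"
proof -
  define xs where "xs = map (\<lambda>x. \<beta> (s x)) [0..<K]"
  define ys where "ys = rev (sort xs)"
  have len: "length xs = K" "length ys = K" by (simp_all add: xs_def ys_def)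
  have \<theta>: "threshold \<beta> m K s = ys ! (m - 1)" by (simp add: threshold_def ys_def xs_def)
  have dec: "ys ! j \<le> ys ! i" if "i \<le> j" "j < K" for i j
    using that sorted_rev_nth_mono[of ys i j] len by (simp add: ys_def)
  have count: "(\<Sum>z | Q (\<beta> z). num_in_state K s z) = card {i. i < K \<and> Q (ys ! i)}" for Q
  proof -
    have "mset (filter Q ys) = mset (filter Q xs)" by (simp add: ys_def)
    then have "length (filter Q ys) = length (filter Q xs)" by (metis size_mset)
    then have "card {i. i < K \<and> Q (ys ! i)} = card {i. i < K \<and> Q (xs ! i)}"
      by (simp add: length_filter_conv_card len)
    also have "{i. i < K \<and> Q (xs ! i)} = {x. x < K \<and> s x \<in> {z. Q (\<beta> z)}}"
      by (auto simp: xs_def)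
    finally show ?thesis by (simp only: sum_num_in_state)
  qed
  have "{i. i < K \<and> ys ! (m - 1) < ys ! i} \<subseteq> {..<m - 1}"
  proof
    fix i assume "i \<in> {i. i < K \<and> ys ! (m - 1) < ys ! i}"
    then show "i \<in> {..<m - 1}" using dec[of "m - 1" i] by (auto simp: not_less[symmetric])
  qed
  from card_mono[OF _ this] show "(\<Sum>z | threshold \<beta> m K s < \<beta> z. num_in_state K s z) < m"
    using m unfolding count \<theta> by simp
  \<comment> \<open>Positions start at 0, so the \<open>m\<close> largest entries are those at \<open>{..<m}\<close>.\<close>
  have "{..<m} \<subseteq> {i. i < K \<and> ys ! (m - 1) \<le> ys ! i}"
    using m dec by auto
  from card_mono[OF _ this] show "m \<le> (\<Sum>z | threshold \<beta> m K s \<le> \<beta> z. num_in_state K s z)"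
    unfolding count \<theta> by simp
qed

lemma index_allocation_above:
  "threshold \<beta> m K s < \<beta> z \<Longrightarrow> index_allocation states \<beta> w m K s z = num_in_state K s z"
  by (simp add: index_allocation_def)

lemma index_allocation_below:
  "\<beta> z < threshold \<beta> m K s \<Longrightarrow> index_allocation states \<beta> w m K s z = 0"
  by (simp add: index_allocation_def tied_states_def)

text \<open>
  The activations left over for the tied states are used up there, and each of these states receives
  at least its share rounded down, unless it has fewer arms than that.
\<close>

lemma index_allocation_tied:
  fixes s :: "nat \<Rightarrow> 's::finite" and \<beta> :: "'s \<Rightarrow> real"
  assumes m: "1 \<le> m" "m \<le> K" and states: "distinct states" "set states = UNIV"
    and nonneg: "\<And>z. 0 \<le> w z"
  defines "I \<equiv> tied_states \<beta> m K s"
    and "A \<equiv> m - (\<Sum>z | threshold \<beta> m K s < \<beta> z. num_in_state K s z)"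
  shows "(\<Sum>z\<in>I. index_allocation states \<beta> w m K s z) = A"
    and "z \<in> I \<Longrightarrow> index_allocation states \<beta> w m K s z \<le> num_in_state K s z"
    and "z \<in> I \<Longrightarrow> min (num_in_state K s z) (nat \<lfloor>real A * tie_fraction \<beta> w m K s z\<rfloor>)
           \<le> index_allocation states \<beta> w m K s z"
proof -
  define \<theta> where "\<theta> = threshold \<beta> m K s"
  define L where "L = filter (\<lambda>z. z \<in> I) states"
  let ?q = "tie_fraction \<beta> w m K s" and ?N = "num_in_state K s"
  define b where "b = rounding A (map ?q L) (map ?N L)"
  have L: "distinct L" "set L = I" using states by (auto simp: L_def)
  have "(\<Sum>z | \<theta> \<le> \<beta> z. ?N z) = (\<Sum>z\<in>{z. \<theta> < \<beta> z} \<union> I. ?N z)"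
    by (rule sum.mono_neutral_right) (auto simp: I_def tied_states_def \<theta>_def)
  also have "\<dots> = (\<Sum>z | \<theta> < \<beta> z. ?N z) + (\<Sum>z\<in>I. ?N z)"
    by (rule sum.union_disjoint) (auto simp: I_def tied_states_def \<theta>_def)
  finally have A: "1 \<le> A" "A \<le> (\<Sum>z\<in>I. ?N z)"
    using threshold_counts[OF m, where \<beta> = \<beta> and s = s] unfolding A_def \<theta>_def by linarith+
  have q_nonneg: "0 \<le> ?q z" for z
    unfolding tie_fraction_def Let_def by (auto intro!: divide_nonneg_nonneg sum_nonneg nonneg)
  have q_sum: "(\<Sum>z\<in>I. ?q z) = 1"
  proof (cases "0 < (\<Sum>z\<in>I. w z)")
    case True
    then show ?thesis
      by (simp add: tie_fraction_def I_def[symmetric] sum_divide_distrib[symmetric])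
  next
    case False
    have "real (\<Sum>z\<in>I. ?N z) \<noteq> 0" using A by linarith
    then show ?thesis using False
      by (simp add: tie_fraction_def I_def[symmetric] sum_divide_distrib[symmetric])
  qed
  have "length b = length L \<and> sum_list b = A \<and>
      (\<forall>i<length L. min (?N (L ! i)) (nat \<lfloor>real A * ?q (L ! i)\<rfloor>) \<le> b ! i \<and> b ! i \<le> ?N (L ! i))"
    using rounding_spec[of "map ?q L" "map ?N L" A] A q_nonneg q_sum L
    by (auto simp: b_def sum_list_distinct_conv_sum_set)
  then have len: "length b = length L" and sum_b: "sum_list b = A"
    and b: "\<And>i. i < length L \<Longrightarrow> min (?N (L ! i)) (nat \<lfloor>real A * ?q (L ! i)\<rfloor>) \<le> b ! i"
      "\<And>i. i < length L \<Longrightarrow> b ! i \<le> ?N (L ! i)"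
    by auto
  have alloc: "index_allocation states \<beta> w m K s (L ! i) = b ! i" if i: "i < length L" for i
  proof -
    have I: "L ! i \<in> I" using i L(2) nth_mem by blast
    then have "index_allocation states \<beta> w m K s (L ! i) = tie_allocation states \<beta> w m K s (L ! i)"
      unfolding index_allocation_def I_def by (simp add: tied_states_def)
    also have "\<dots> = the (map_of (zip L b) (L ! i))"
      by (simp add: tie_allocation_def Let_def L_def I_def b_def A_def)
    also have "\<dots> = b ! i"
      using len L i by (simp add: map_of_zip_nth)
    finally show ?thesis .
  qed
  have "map (index_allocation states \<beta> w m K s) L = b"
    using alloc len by (intro nth_equalityI) auto
  then show "(\<Sum>z\<in>I. index_allocation states \<beta> w m K s z) = A"
    using sum_b L by (metis sum_list_distinct_conv_sum_set)
  assume "z \<in> I"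
  then obtain i where "i < length L" "z = L ! i" using L(2) by (metis in_set_conv_nth)
  then show "index_allocation states \<beta> w m K s z \<le> ?N z"
    "min (?N z) (nat \<lfloor>real A * ?q z\<rfloor>) \<le> index_allocation states \<beta> w m K s z"
    using alloc b by auto
qed

lemma index_allocation_le:
  fixes s :: "nat \<Rightarrow> 's::finite"
  assumes "1 \<le> m" "m \<le> K" "distinct states" "set states = UNIV" "\<And>z. 0 \<le> w z"
  shows "index_allocation states \<beta> w m K s z \<le> num_in_state K s z"
  using index_allocation_tied(2)[OF assms, where z = z and \<beta> = \<beta> and s = s] by (auto simp: index_allocation_def)

lemma sum_index_allocation:
  fixes s :: "nat \<Rightarrow> 's::finite"
  assumes m: "1 \<le> m" "m \<le> K" and "distinct states" "set states = UNIV" "\<And>z. 0 \<le> w z"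
  shows "(\<Sum>z\<in>UNIV. index_allocation states \<beta> w m K s z) = m"
proof -
  let ?b = "index_allocation states \<beta> w m K s" and ?I = "tied_states \<beta> m K s"
    and ?H = "{z. threshold \<beta> m K s < \<beta> z}"
  have "(\<Sum>z\<in>UNIV. ?b z) = (\<Sum>z\<in>?H \<union> ?I. ?b z)"
    by (rule sum.mono_neutral_right) (auto simp: index_allocation_def)
  also have "\<dots> = (\<Sum>z\<in>?H. ?b z) + (\<Sum>z\<in>?I. ?b z)"
    by (rule sum.union_disjoint) (auto simp: tied_states_def)
  also have "(\<Sum>z\<in>?H. ?b z) = (\<Sum>z\<in>?H. num_in_state K s z)"
    by (rule sum.cong) (auto simp: index_allocation_above)
  finally show ?thesis
    using index_allocation_tied(1)[OF assms, where \<beta> = \<beta> and s = s] threshold_counts(1)[OF m, where \<beta> = \<beta> and s = s] by simp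
qed


section \<open>Stability of the allocation\<close>

text \<open>
  The allocation follows the activity of the occupation measure, with an error that is
  linear in the deviation \<open>E\<close> of the numbers of arms from their prescribed sizes \<open>k * (\<rho>0 + \<rho>1)\<close>.
  Here \<open>l\<close> is the multiplier, and \<open>\<theta>\<close> is the empirical threshold. If \<open>\<theta> > l\<close>, nearly all arms
  with index above \<open>l\<close> are active and the remaining activity of the measure is small; if
  \<open>\<theta> < l\<close>, all arms with index at least \<open>l\<close> are active, which uses up nearly all activations; and if
  \<open>\<theta> = l\<close>, the lower bound on the shares of the tied states forces each share to be nearly right,
  because the shares add up to nearly the right total.
\<close>

lemma allocation_stable:
  fixes \<beta> \<rho>0 \<rho>1 N b :: "'s::finite \<Rightarrow> real" and k m \<alpha> l \<theta> E :: real
  assumes k: "0 \<le> k" and m: "\<alpha> * k - 1 \<le> m" "m \<le> \<alpha> * k"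
    and nonneg: "\<And>z. 0 \<le> \<rho>0 z" "\<And>z. 0 \<le> \<rho>1 z" and sum_\<rho>1: "(\<Sum>z\<in>UNIV. \<rho>1 z) = \<alpha>"
    and above: "\<And>z. l < \<beta> z \<Longrightarrow> \<rho>0 z = 0" and below: "\<And>z. \<beta> z < l \<Longrightarrow> \<rho>1 z = 0"
    and b_above: "\<And>z. \<theta> < \<beta> z \<Longrightarrow> b z = N z" and b_below: "\<And>z. \<beta> z < \<theta> \<Longrightarrow> b z = 0"
    and b: "\<And>z. 0 \<le> b z" "\<And>z. b z \<le> N z" and sum_b: "(\<Sum>z\<in>UNIV. b z) = m"
    and tied: "\<And>z. \<beta> z = \<theta> \<Longrightarrow> 0 < N z \<Longrightarrow> 0 < (\<Sum>z | \<beta> z = \<theta> \<and> 0 < N z. \<rho>1 z) \<Longrightarrow>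
        min (N z) ((m - (\<Sum>z | \<theta> < \<beta> z. N z)) * (\<rho>1 z / (\<Sum>z | \<beta> z = \<theta> \<and> 0 < N z. \<rho>1 z)) - 1) \<le> b z"
  defines "E \<equiv> \<Sum>z\<in>UNIV. \<bar>N z - k * (\<rho>0 z + \<rho>1 z)\<bar>"
  shows "\<bar>b z - k * \<rho>1 z\<bar> \<le> (2 * real CARD('s) + 1) * (E + 1)"
proof -
  have E_set: "\<bar>\<Sum>z\<in>A. N z - k * (\<rho>0 z + \<rho>1 z)\<bar> \<le> E" for A
  proof -
    have "\<bar>\<Sum>z\<in>A. N z - k * (\<rho>0 z + \<rho>1 z)\<bar> \<le> (\<Sum>z\<in>A. \<bar>N z - k * (\<rho>0 z + \<rho>1 z)\<bar>)" by (rule sum_abs)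
    also have "\<dots> \<le> E" unfolding E_def by (rule sum_mono2) auto
    finally show ?thesis .
  qed
  have E_lower: "k * (\<Sum>z\<in>A. \<rho>1 z) - E \<le> (\<Sum>z\<in>A. N z)" for A
  proof -
    have "(\<Sum>z\<in>A. k * \<rho>1 z) \<le> (\<Sum>z\<in>A. k * (\<rho>0 z + \<rho>1 z))"
      using k nonneg by (intro sum_mono mult_left_mono) auto
    then show ?thesis using E_set[of A] by (simp add: sum_subtractf sum_distrib_left)
  qed
  have E_above: "(\<Sum>z\<in>A. N z) \<le> k * (\<Sum>z\<in>A. \<rho>1 z) + E" if "\<And>z. z \<in> A \<Longrightarrow> l < \<beta> z" for A
  proof -
    have "(\<Sum>z\<in>A. k * (\<rho>0 z + \<rho>1 z)) = (\<Sum>z\<in>A. k * \<rho>1 z)"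
      using that above by (intro sum.cong) auto
    then show ?thesis using E_set[of A] by (simp add: sum_subtractf sum_distrib_left)
  qed
  have E_lower1: "k * \<rho>1 z - E \<le> N z" for z using E_lower[of "{z}"] by simp
  have E_above1: "N z \<le> k * \<rho>1 z + E" if "l < \<beta> z" for z using E_above[of "{z}"] that by simp
  have E0: "0 \<le> E" using E_set[of "{}"] by simp
  have k\<rho>: "0 \<le> k * \<rho>1 z" for z using k nonneg by simp
  have kA: "k * (\<Sum>z\<in>A. \<rho>1 z) \<le> \<alpha> * k" for A
    using sum_mono2[of UNIV A \<rho>1] nonneg k
    by (simp add: sum_\<rho>1 mult.commute[of \<alpha>] mult_left_mono)
  have split: "f z = sum f A - sum f (A - {z})" if "z \<in> A" for f :: "'s \<Rightarrow> real" and A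
    using that by (simp add: sum_diff1)
  have S1: "1 \<le> real CARD('s)" by (simp add: Suc_le_eq)
  have weak: "x \<le> (2 * real CARD('s) + 1) * (E + 1)" if "x \<le> 2 * E + 2" for x
  proof -
    have "2 \<le> 2 * real CARD('s) + 1" using S1 by linarith
    then have "2 * (E + 1) \<le> (2 * real CARD('s) + 1) * (E + 1)"
      using E0 by (intro mult_right_mono) auto
    with that show ?thesis by (simp add: algebra_simps)
  qed
  have weak_abs: "\<bar>x - y\<bar> \<le> (2 * real CARD('s) + 1) * (E + 1)"
    if "x - y \<le> 2 * E + 2" "y - x \<le> 2 * E + 2" for x y
    using weak[OF that(1)] weak[OF that(2)] by simp
  \<comment> \<open>All but one of the following estimates stay below \<open>2 * E + 2\<close>.\<close>
  consider "l < \<theta>" | "\<theta> < l" | "\<theta> = l" by linarith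
  then show ?thesis
  proof cases
    case 1
    define H where "H = {z. l < \<beta> z}"
    have out: "b z = 0" if "z \<notin> H" for z using that 1 b_below by (simp add: H_def)
    have "sum b UNIV = sum b H" by (rule sum.mono_neutral_right) (auto simp: out)
    then have bH: "sum b H = m" using sum_b by simp
    have NH: "sum N H \<le> k * sum \<rho>1 H + E" by (rule E_above) (simp add: H_def)
    have bN: "sum b H \<le> sum N H" by (intro sum_mono b)
    show ?thesis
    proof (cases "z \<in> H")
      case True
      have "sum b (H - {z}) \<le> sum N (H - {z})" by (intro sum_mono b)
      then have "N z - b z \<le> E + 1"
        using split[OF True, of b] split[OF True, of N] NH kA[of H] bH m by simp
      moreover have "b z \<le> N z" by (rule b)
      moreover have "N z \<le> k * \<rho>1 z + E" using True by (intro E_above1) (simp add: H_def)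
      moreover have "k * \<rho>1 z - E \<le> N z" by (rule E_lower1)
      ultimately show ?thesis using E0 by - (rule weak_abs; linarith)
    next
      case False
      have "\<rho>1 z + sum \<rho>1 H = sum \<rho>1 (insert z H)" using False by simp
      then have "k * \<rho>1 z + k * sum \<rho>1 H \<le> \<alpha> * k"
        using kA[of "insert z H"] by (simp flip: distrib_left)
      then have "k * \<rho>1 z \<le> E + 1" using NH bN bH m by linarith
      then show ?thesis using out[OF False] k\<rho>[of z] E0 by - (rule weak_abs; linarith)
    qed
  next
    case 2
    define G where "G = {z. l \<le> \<beta> z}"
    have bG: "b z = N z" if "z \<in> G" for z using that 2 by (intro b_above) (simp add: G_def)
    have "sum \<rho>1 UNIV = sum \<rho>1 G"
      by (rule sum.mono_neutral_right) (auto simp: G_def intro!: below)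
    then have \<rho>G: "k * sum \<rho>1 G = \<alpha> * k" using sum_\<rho>1 by simp
    have sum_bG: "sum b A = sum N A" if "A \<subseteq> G" for A
      using that by (intro sum.cong) (auto simp: bG)
    have NG: "sum N G \<le> m"
      using sum_mono2[of UNIV G b] b(1) sum_bG[of G] sum_b by simp
    show ?thesis
    proof (cases "z \<in> G")
      case True
      have "k * sum \<rho>1 (G - {z}) - E \<le> sum N (G - {z})" by (rule E_lower)
      moreover have "k * sum \<rho>1 (G - {z}) = k * sum \<rho>1 G - k * \<rho>1 z"
        using True by (simp add: sum_diff1 right_diff_distrib)
      ultimately have "N z \<le> k * \<rho>1 z + E"
        using split[OF True, of N] NG m \<rho>G by linarith
      then show ?thesis using bG[OF True] E_lower1[of z] E0 by - (rule weak_abs; linarith)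
    next
      case False
      then have "k * \<rho>1 z = 0" using below[of z] by (simp add: G_def)
      moreover have "b z + sum b G \<le> m"
        using sum_mono2[of UNIV "insert z G" b] b(1) sum_b False by simp
      moreover have "k * sum \<rho>1 G - E \<le> sum N G" by (rule E_lower)
      ultimately show ?thesis using sum_bG[OF order.refl] m \<rho>G b(1)[of z] E0 by - (rule weak_abs; linarith)
    qed
  next
    case 3
    define H where "H = {z. l < \<beta> z}"
    define Q where "Q = {z. \<beta> z = l}"
    define I where "I = {z. \<beta> z = \<theta> \<and> 0 < N z}"
    have "sum \<rho>1 UNIV = sum \<rho>1 (H \<union> Q)"
      by (rule sum.mono_neutral_right) (auto simp: H_def Q_def intro!: below)
    also have "\<dots> = sum \<rho>1 H + sum \<rho>1 Q" by (rule sum.union_disjoint) (auto simp: H_def Q_def)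
    finally have \<rho>HQ: "k * sum \<rho>1 H + k * sum \<rho>1 Q = \<alpha> * k"
      using sum_\<rho>1 by (simp flip: distrib_left)
    have "sum b UNIV = sum b (H \<union> Q)"
      by (rule sum.mono_neutral_right) (use 3 in \<open>auto simp: H_def Q_def intro!: b_below\<close>)
    also have "\<dots> = sum b H + sum b Q" by (rule sum.union_disjoint) (auto simp: H_def Q_def)
    also have "sum b H = sum N H" using 3 by (intro sum.cong b_above) (auto simp: H_def)
    finally have bQ: "sum b Q = m - sum N H" using sum_b by simp
    have H: "{z. \<theta> < \<beta> z} = H" using 3 by (simp add: H_def)
    have NH: "sum N H \<le> k * sum \<rho>1 H + E" "k * sum \<rho>1 H - E \<le> sum N H"
      by (rule E_above, simp add: H_def) (rule E_lower)
    have lower: "k * \<rho>1 z - E - 2 \<le> b z" if z: "z \<in> Q" for z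
    proof (cases "z \<in> I")
      case False
      then have "N z \<le> 0" using z 3 by (simp add: I_def Q_def)
      then show ?thesis using E_lower1[of z] b(1)[of z] by linarith
    next
      case True
      define D where "D = sum \<rho>1 I"
      have "\<rho>1 z \<le> D" unfolding D_def by (rule member_le_sum) (use True nonneg in auto)
      show ?thesis
      proof (cases "0 < D")
        case False
        then have "\<rho>1 z = 0" using \<open>\<rho>1 z \<le> D\<close> nonneg(2)[of z] by simp
        then show ?thesis using b(1)[of z] E0 by simp
      next
        case pos: True
        have "D \<le> sum \<rho>1 Q"
          unfolding D_def by (rule sum_mono2) (use 3 nonneg in \<open>auto simp: I_def Q_def\<close>)
        then have "k * D \<le> k * sum \<rho>1 Q" using k by (rule mult_left_mono)
        then have "k * D - (E + 1) \<le> m - sum N H" using \<rho>HQ NH m by linarith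
        then have "(k * D - (E + 1)) * (\<rho>1 z / D) \<le> (m - sum N H) * (\<rho>1 z / D)"
          using pos nonneg by (intro mult_right_mono) auto
        moreover have "(k * D - (E + 1)) * (\<rho>1 z / D) = k * \<rho>1 z - (E + 1) * (\<rho>1 z / D)"
          using pos by (simp add: field_simps)
        moreover
        have "(E + 1) * (\<rho>1 z / D) \<le> (E + 1) * 1"
          using pos E0 \<open>\<rho>1 z \<le> D\<close> by (intro mult_left_mono) auto
        then have "(E + 1) * (\<rho>1 z / D) \<le> E + 1" by (simp only: mult_1_right)
        moreover have "min (N z) ((m - sum N H) * (\<rho>1 z / D) - 1) \<le> b z"
          using tied[of z] True pos unfolding H D_def I_def by simp
        ultimately show ?thesis using E_lower1[of z] by linarith
      qed
    qed
    consider "z \<in> H" | "z \<in> Q" | "\<beta> z < l" unfolding H_def Q_def by fastforce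
    then show ?thesis
    proof cases
      case 1
      then have "b z = N z" using 3 by (intro b_above) (simp add: H_def)
      then show ?thesis
        using E_lower1[of z] E_above1[of z] 1 E0 by - (rule weak_abs; simp add: H_def)
    next
      case z: 2
      \<comment> \<open>The upper bound at \<open>z\<close> follows from the total over \<open>Q\<close> and the lower bounds at the other states.\<close>
      have "(\<Sum>z\<in>Q - {z}. k * \<rho>1 z - E - 2) \<le> sum b (Q - {z})"
        by (intro sum_mono lower) auto
      moreover have "(\<Sum>z\<in>Q - {z}. k * \<rho>1 z - E - 2) = k * sum \<rho>1 (Q - {z}) - real (card (Q - {z})) * (E + 2)"
        by (simp add: sum_subtractf sum_distrib_left algebra_simps)
      moreover have "real (card (Q - {z})) * (E + 2) \<le> real CARD('s) * (2 * (E + 1))"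
        using E0 by (intro mult_mono) (auto intro!: card_mono)
      moreover have "k * sum \<rho>1 (Q - {z}) = k * sum \<rho>1 Q - k * \<rho>1 z"
        using z by (simp add: sum_diff1 right_diff_distrib)
      ultimately have "b z - k * \<rho>1 z \<le> (E + 1) + real CARD('s) * (2 * (E + 1))"
        using split[OF z, of b] bQ NH \<rho>HQ m by linarith
      then have "b z - k * \<rho>1 z \<le> (2 * real CARD('s) + 1) * (E + 1)"
        by (simp add: algebra_simps)
      moreover have "k * \<rho>1 z - b z \<le> (2 * real CARD('s) + 1) * (E + 1)"
        using lower[OF z] E0 by (intro weak) simp
      ultimately show ?thesis by simp
    next
      case 3
      then have "b z = 0" using \<open>\<theta> = l\<close> by (intro b_below) simp
      then show ?thesis using below[OF 3] E0 by (intro weak_abs) simp_all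
    qed
  qed
qed


section \<open>Fluctuations of the state counts\<close>

text \<open>
  A sum of independent variables that are centred and bounded by 1 has as second moment the sum of
  their second moments, and hence at most their number.
\<close>

lemma Pi_pmf_second_moment_le:
  fixes f :: "'a \<Rightarrow> 'b \<Rightarrow> real"
  assumes "finite A" and fin: "\<And>x. finite (set_pmf (p x))"
    and mean: "\<And>x. measure_pmf.expectation (p x) (f x) = 0" and bound: "\<And>x v. \<bar>f x v\<bar> \<le> 1"
  shows "measure_pmf.expectation (Pi_pmf A d p) (\<lambda>y. \<Sum>x\<in>A. f x (y x)) = 0
       \<and> measure_pmf.expectation (Pi_pmf A d p) (\<lambda>y. (\<Sum>x\<in>A. f x (y x))\<^sup>2) \<le> real (card A)"
  using \<open>finite A\<close>
proof (induction A rule: finite_induct)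
  case empty
  then show ?case by simp
next
  case (insert x A)
  let ?S = "\<lambda>y. \<Sum>i\<in>A. f i (y i)"
  have finA: "finite (set_pmf (Pi_pmf A d p))" by (rule finite_set_Pi_pmf) (use insert fin in auto)
  note int = integrable_measure_pmf_finite[OF finA]
  have upd: "(\<Sum>i\<in>insert x A. f i ((y(x := v)) i)) = f x v + ?S y" for y v
    using insert by (auto intro!: sum.cong)
  have "measure_pmf.expectation (Pi_pmf (insert x A) d p) h
      = measure_pmf.expectation (p x) (\<lambda>v. measure_pmf.expectation (Pi_pmf A d p) (\<lambda>y. h (y(x := v))))"
    for h :: "('a \<Rightarrow> 'b) \<Rightarrow> real"
    using insert by (simp add: Pi_pmf_insert' expectation_bind_finite fin finA)
  note E = this
  have "measure_pmf.expectation (Pi_pmf A d p) (\<lambda>y. (f x v + ?S y)\<^sup>2) \<le> 1 + real (card A)" for v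
  proof -
    have "measure_pmf.expectation (Pi_pmf A d p) (\<lambda>y. (f x v + ?S y)\<^sup>2)
        = (f x v)\<^sup>2 + 2 * f x v * measure_pmf.expectation (Pi_pmf A d p) ?S
          + measure_pmf.expectation (Pi_pmf A d p) (\<lambda>y. (?S y)\<^sup>2)"
      by (simp add: power2_sum int mult.assoc)
    moreover have "(f x v)\<^sup>2 \<le> 1" using bound[of x v] by (simp add: abs_square_le_1)
    ultimately show ?thesis using insert.IH by simp
  qed
  then have "measure_pmf.expectation (p x) (\<lambda>v. measure_pmf.expectation (Pi_pmf A d p) (\<lambda>y. (f x v + ?S y)\<^sup>2))
      \<le> measure_pmf.expectation (p x) (\<lambda>_. 1 + real (card A))"
    by (intro expectation_mono_finite fin)
  moreover have "measure_pmf.expectation (p x) (\<lambda>v. measure_pmf.expectation (Pi_pmf A d p) (\<lambda>y. f x v + ?S y)) = 0"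
    using insert.IH mean[of x] by (simp add: int)
  ultimately show ?case
    unfolding E upd using insert by simp
qed

lemma expectation_abs_le_sqrt:
  fixes X :: "'a \<Rightarrow> real"
  assumes fin: "finite (set_pmf p)" and k: "0 < k"
    and le: "measure_pmf.expectation p (\<lambda>x. (X x)\<^sup>2) \<le> k"
  shows "measure_pmf.expectation p (\<lambda>x. \<bar>X x\<bar>) \<le> sqrt k"
proof -
  note int = integrable_measure_pmf_finite[OF fin]
  \<comment> \<open>\<open>2 * c * \<bar>X\<bar> \<le> X\<^sup>2 + c\<^sup>2\<close>, with the optimal choice of \<open>c\<close>\<close>
  have "2 * sqrt k * \<bar>X x\<bar> \<le> (X x)\<^sup>2 + k" for x
    using sum_squares_bound[of "\<bar>X x\<bar>" "sqrt k"] k by (simp add: mult.commute mult.left_commute)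
  then have "measure_pmf.expectation p (\<lambda>x. 2 * sqrt k * \<bar>X x\<bar>) \<le> measure_pmf.expectation p (\<lambda>x. (X x)\<^sup>2 + k)"
    by (rule expectation_mono_finite[OF fin])
  then have "2 * sqrt k * measure_pmf.expectation p (\<lambda>x. \<bar>X x\<bar>) \<le> 2 * sqrt k * sqrt k"
    using le k by (simp add: int)
  then show ?thesis using k by (simp add: mult_le_cancel_left)
qed

lemma num_in_state_eq_sum: "real (num_in_state K s z) = (\<Sum>x<K. of_bool (s x = z))"
proof -
  have "{..<K} \<inter> {x. s x = z} = {x. x < K \<and> s x = z}" by auto
  then show ?thesis by (simp add: num_in_state_def of_bool_def sum.If_cases)
qed

lemma state_count_deviation:
  fixes P :: "'s::finite kernel"
  assumes "1 \<le> K"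
  shows "measure_pmf.expectation (joint_kernel P s1 K s a)
     (\<lambda>s'. \<bar>real (num_in_state K s' z) - (\<Sum>x<K. pmf (P (a x) (s x)) z)\<bar>) \<le> sqrt (real K)"
proof (rule expectation_abs_le_sqrt)
  define f where "f x v = of_bool (v = z) - pmf (P (a x) (s x)) z" for x :: nat and v
  have mean: "measure_pmf.expectation (P (a x) (s x)) (f x) = 0" for x
  proof -
    have "measure_pmf.expectation (P (a x) (s x)) (f x)
        = measure_pmf.expectation (P (a x) (s x)) (\<lambda>v. of_bool (v = z)) - pmf (P (a x) (s x)) z"
      unfolding f_def by (simp add: integrable_measure_pmf_finite)
    also have "measure_pmf.expectation (P (a x) (s x)) (\<lambda>v. of_bool (v = z)) = pmf (P (a x) (s x)) z"
      by (subst integral_measure_pmf[of "{z}"]) auto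
    finally show ?thesis by simp
  qed
  have bound: "\<bar>f x v\<bar> \<le> 1" for x v
    using pmf_nonneg[of "P (a x) (s x)" z] pmf_le_1[of "P (a x) (s x)" z] by (simp add: f_def)
  have "real (num_in_state K s' z) - (\<Sum>x<K. pmf (P (a x) (s x)) z) = (\<Sum>x\<in>{..<K}. f x (s' x))" for s'
    by (simp add: num_in_state_eq_sum f_def sum_subtractf)
  then show "measure_pmf.expectation (joint_kernel P s1 K s a)
     (\<lambda>s'. (real (num_in_state K s' z) - (\<Sum>x<K. pmf (P (a x) (s x)) z))\<^sup>2) \<le> real K"
    unfolding joint_kernel_def
    using Pi_pmf_second_moment_le[of "{..<K}" "\<lambda>x. P (a x) (s x)" f s1] mean bound by simp
qed (use assms finite_set_joint_kernel in auto)

lemma sum_by_state: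
  fixes s :: "nat \<Rightarrow> 's::finite" and F :: "'s \<Rightarrow> bool \<Rightarrow> real"
  shows "(\<Sum>x<K. F (s x) (a x)) = (\<Sum>z\<in>UNIV. real (card {x. x < K \<and> s x = z \<and> a x}) * F z True
     + (real (num_in_state K s z) - real (card {x. x < K \<and> s x = z \<and> a x})) * F z False)"
proof -
  have "(\<Sum>x<K. F (s x) (a x)) = (\<Sum>z\<in>UNIV. \<Sum>x | x \<in> {..<K} \<and> s x = z. F (s x) (a x))"
    by (rule sum.group[symmetric]) auto
  also have "\<dots> = (\<Sum>z\<in>UNIV. real (card {x. x < K \<and> s x = z \<and> a x}) * F z True
     + (real (num_in_state K s z) - real (card {x. x < K \<and> s x = z \<and> a x})) * F z False)"
  proof (rule sum.cong[OF refl])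
    fix z
    let ?X = "{x. x \<in> {..<K} \<and> s x = z}"
    have X: "card (?X \<inter> {x. a x}) = card {x. x < K \<and> s x = z \<and> a x}"
      by (rule arg_cong[of _ _ card]) auto
    have N: "card ?X = num_in_state K s z" by (simp add: num_in_state_def)
    have "card ?X = card (?X \<inter> {x. a x}) + card (?X \<inter> - {x. a x})"
      by (subst card_Un_disjoint[symmetric]) (auto intro!: arg_cong[of _ _ card])
    then have X': "real (card (?X \<inter> - {x. a x})) = real (num_in_state K s z) - real (card {x. x < K \<and> s x = z \<and> a x})"
      using N X by simp
    have "(\<Sum>x\<in>?X. F (s x) (a x)) = (\<Sum>x\<in>?X. if a x then F z True else F z False)"
      by (rule sum.cong) auto
    also have "\<dots> = real (card (?X \<inter> {x. a x})) * F z True + real (card (?X \<inter> - {x. a x})) * F z False"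
      by (subst sum.If_cases) auto
    finally show "(\<Sum>x\<in>?X. F (s x) (a x)) = real (card {x. x < K \<and> s x = z \<and> a x}) * F z True
     + (real (num_in_state K s z) - real (card {x. x < K \<and> s x = z \<and> a x})) * F z False"
      unfolding X X' .
  qed
  finally show ?thesis .
qed


section \<open>Feasibility of the index policy\<close>

lemma action_in_run:
  "h \<in> set_pmf (run D \<pi> n t s) \<Longrightarrow> i < n \<Longrightarrow> \<exists>s'. snd (h ! i) \<in> set_pmf (\<pi> (t + i) s')"
proof (induction n arbitrary: h i t s)
  case (Suc n)
  then obtain a s' h' where a: "a \<in> set_pmf (\<pi> t s)" and h': "h' \<in> set_pmf (run D \<pi> n (Suc t) s')"
    and h: "h = (s, a) # h'"
    by auto
  show ?case
  proof (cases i)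
    case 0
    then show ?thesis using a h by auto
  next
    case (Suc j)
    then show ?thesis using Suc.IH[OF h', of j] Suc.prems(2) h by simp
  qed
qed simp

text \<open>Here \<open>s\<close> is arbitrary: it only serves to group the arms.\<close>

lemma num_active_eq:
  fixes s :: "nat \<Rightarrow> 's::finite"
  shows "num_active K a = (\<Sum>z\<in>UNIV. card {x. x < K \<and> s x = z \<and> a x})"
proof -
  have "real (num_active K a) = (\<Sum>z\<in>UNIV. real (card {x. x < K \<and> s x = z \<and> a x}))"
    using sum_by_state[of "\<lambda>_ b. of_bool b" s a K] by (simp add: num_active_def)
  then show ?thesis by (simp flip: of_nat_sum)
qed

lemma index_policy_active:
  fixes P :: "'s::finite kernel"
  assumes pol: "index_policy T P r states lam \<rho> m K \<pi>" and m: "1 \<le> m" "m \<le> K"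
    and states: "distinct states" "set states = UNIV"
    and nonneg: "\<And>t s. t \<in> {1..T} \<Longrightarrow> 0 \<le> \<rho> s True t"
  shows "\<pi> \<in> policies_active T P s1 m K"
  unfolding policies_active_def
proof (intro CollectI conjI ballI)
  show "\<pi> \<in> policies K" using pol by (simp add: index_policy_def)
  fix t assume t: "t \<in> {1..T}"
  have "num_active K (action_at h t) = m" if h: "h \<in> set_pmf (trajectory T P s1 K \<pi>)" for h
  proof -
    have "t - 1 < T" using t by auto
    then obtain s where s: "action_at h t \<in> set_pmf (\<pi> t s)"
      using action_in_run[OF h[unfolded trajectory_def], of "t - 1"] t by (auto simp: action_at_def)
    have "num_active K (action_at h t)
        = (\<Sum>z\<in>UNIV. index_allocation states (arm_index T P r lam t) (\<lambda>z'. \<rho> z' True t) m K s z)"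
      using pol t s unfolding num_active_eq[of K "action_at h t" s] index_policy_def by simp
    then show ?thesis using sum_index_allocation[OF m states, of "\<lambda>z'. \<rho> z' True t"] nonneg[OF t] by simp
  qed
  then show "measure_pmf.prob (trajectory T P s1 K \<pi>) {h. num_active K (action_at h t) = m} = 1"
    by (subst measure_pmf.prob_eq_1) (auto simp: AE_measure_pmf_iff)
qed


section \<open>The index policy follows the occupation measure\<close>

text \<open>
  Distance of the numbers of arms in the different states at time \<open>t\<close> from the sizes which the
  occupation measure prescribes for \<open>K\<close> arms.
\<close>

definition deviation :: "('s::finite \<Rightarrow> bool \<Rightarrow> nat \<Rightarrow> real) \<Rightarrow> nat \<Rightarrow> nat \<Rightarrow> (nat \<Rightarrow> 's) \<Rightarrow> real" where
  "deviation \<rho> K t s = (\<Sum>z\<in>UNIV. \<bar>real (num_in_state K s z) - real K * (\<rho> z False t + \<rho> z True t)\<bar>)"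

lemma deviation_nonneg: "0 \<le> deviation \<rho> K t s"
  by (simp add: deviation_def sum_nonneg)

text \<open>
  By complementary slackness, the occupation measure is compatible with the order of the indices
  relative to the multiplier, so the stability of the allocation applies.
\<close>

lemma index_policy_activation_close:
  fixes P :: "'s::finite kernel"
  assumes min: "\<And>lam'. tail_val T P r lam 1 s1 + \<alpha> * (\<Sum>t=1..T. lam t)
       \<le> tail_val T P r lam' 1 s1 + \<alpha> * (\<Sum>t=1..T. lam' t)"
    and opt: "occupation_optimal T P r s1 \<alpha> lam \<rho>"
    and pol: "index_policy T P r states lam \<rho> m K \<pi>" and m: "1 \<le> m" "m \<le> K"
    and m_\<alpha>: "\<alpha> * real K - 1 \<le> real m" "real m \<le> \<alpha> * real K"
    and states: "distinct states" "set states = UNIV"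
    and t: "t \<in> {1..T}" and a: "a \<in> set_pmf (\<pi> t s)"
  shows "\<bar>real (card {x. x < K \<and> s x = z \<and> a x}) - real K * \<rho> z True t\<bar>
       \<le> (2 * real CARD('s) + 1) * (deviation \<rho> K t s + 1)"
proof -
  have feas: "flow_measure T P s1 \<rho>" "(\<Sum>z\<in>UNIV. \<rho> z True t) = \<alpha>"
    using opt t by (auto simp: occupation_optimal_def occupation_feasible_iff)
  note nonneg = flow_measure_nonneg[OF feas(1) t]
  let ?\<beta> = "arm_index T P r lam t" and ?\<rho>1 = "\<lambda>z. \<rho> z True t"
  let ?\<theta> = "threshold ?\<beta> m K s" and ?I = "tied_states ?\<beta> m K s" and ?N = "num_in_state K s"
  let ?b = "index_allocation states ?\<beta> ?\<rho>1 m K s"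
  note supp = occupation_optimal_support[OF min opt t]
  have card: "card {x. x < K \<and> s x = z \<and> a x} = ?b z"
    using pol t a by (simp add: index_policy_def)
  have I: "{z. ?\<beta> z = ?\<theta> \<and> 0 < real (?N z)} = ?I" by (auto simp: tied_states_def)
  show ?thesis
    unfolding card deviation_def
  proof (rule allocation_stable[where \<beta> = ?\<beta> and l = "lam t" and \<theta> = ?\<theta> and m = "real m" and \<alpha> = \<alpha>])
    show "\<rho> z False t = 0" if "lam t < ?\<beta> z" for z
      using supp[of z False True] that unfolding arm_index_eq[OF t] by force
    show "\<rho> z True t = 0" if "?\<beta> z < lam t" for z
      using supp[of z True False] that unfolding arm_index_eq[OF t] by force
    show "real (?b z) \<le> real (?N z)" for z
      using index_allocation_le[OF m states, of ?\<rho>1] nonneg by simp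
    show "(\<Sum>z\<in>UNIV. real (?b z)) = real m"
      using sum_index_allocation[OF m states, of ?\<rho>1] nonneg by (simp flip: of_nat_sum)
    fix z assume z: "?\<beta> z = ?\<theta>" "0 < real (?N z)"
      and pos: "0 < (\<Sum>z | ?\<beta> z = ?\<theta> \<and> 0 < real (?N z). ?\<rho>1 z)"
    define A where "A = m - (\<Sum>z | ?\<theta> < ?\<beta> z. ?N z)"
    have A: "real A = real m - (\<Sum>z | ?\<theta> < ?\<beta> z. real (?N z))"
      using threshold_counts(1)[OF m, where \<beta> = ?\<beta> and s = s] unfolding A_def
      by (simp add: of_nat_diff)
    have q: "tie_fraction ?\<beta> ?\<rho>1 m K s z = ?\<rho>1 z / (\<Sum>z\<in>?I. ?\<rho>1 z)"
      using pos unfolding I tie_fraction_def by simp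
    have "z \<in> ?I" using z by (simp add: tied_states_def)
    then have "min (?N z) (nat \<lfloor>real A * tie_fraction ?\<beta> ?\<rho>1 m K s z\<rfloor>) \<le> ?b z"
      using index_allocation_tied(3)[OF m states, where \<beta> = ?\<beta> and s = s and z = z and w = ?\<rho>1] nonneg
      unfolding A_def by blast
    moreover have "real A * tie_fraction ?\<beta> ?\<rho>1 m K s z - 1 \<le> real (nat \<lfloor>real A * tie_fraction ?\<beta> ?\<rho>1 m K s z\<rfloor>)"
      by linarith
    ultimately show "min (real (?N z)) ((real m - (\<Sum>z | ?\<theta> < ?\<beta> z. real (?N z)))
        * (?\<rho>1 z / (\<Sum>z | ?\<beta> z = ?\<theta> \<and> 0 < real (?N z). ?\<rho>1 z)) - 1) \<le> real (?b z)"
      unfolding I A[symmetric] q by linarith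
  qed (use m_\<alpha> nonneg feas in \<open>auto simp: index_allocation_above index_allocation_below\<close>)
qed

text \<open>
  Hence a sum over the arms of a quantity that depends on their states and actions is close to
  its average under the occupation measure.
\<close>

lemma sum_over_arms_close:
  fixes \<rho> :: "'s::finite \<Rightarrow> bool \<Rightarrow> nat \<Rightarrow> real"
  assumes close: "\<And>z. \<bar>real (card {x. x < K \<and> s x = z \<and> a x}) - real K * \<rho> z True t\<bar> \<le> c * (deviation \<rho> K t s + 1)"
    and c: "0 \<le> c" and F: "\<And>z b. \<bar>F z b\<bar> \<le> B"
  shows "\<bar>(\<Sum>x<K. F (s x) (a x)) - real K * (\<Sum>b\<in>UNIV. \<Sum>z\<in>UNIV. \<rho> z b t * F z b)\<bar>
       \<le> B * (real CARD('s) * (2 * c + 1)) * (deviation \<rho> K t s + 1)"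
proof -
  define A where "A z = real (card {x. x < K \<and> s x = z \<and> a x})" for z
  define N where "N z = real (num_in_state K s z)" for z
  define e where "e = deviation \<rho> K t s + 1"
  have B: "0 \<le> B" using F[of undefined undefined] by linarith
  have e: "1 \<le> e" by (simp add: e_def deviation_nonneg)
  have dev: "\<bar>N z - real K * (\<rho> z False t + \<rho> z True t)\<bar> \<le> e" for z
    using member_le_sum[of z UNIV "\<lambda>z. \<bar>N z - real K * (\<rho> z False t + \<rho> z True t)\<bar>"]
    by (simp add: e_def deviation_def N_def)
  have "(\<Sum>x<K. F (s x) (a x)) - real K * (\<Sum>b\<in>UNIV. \<Sum>z\<in>UNIV. \<rho> z b t * F z b)
      = (\<Sum>z\<in>UNIV. (A z - real K * \<rho> z True t) * F z True + (N z - A z - real K * \<rho> z False t) * F z False)"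
    unfolding sum_by_state A_def[symmetric] N_def[symmetric]
    by (simp add: UNIV_bool sum.distrib sum_subtractf sum_distrib_left algebra_simps)
  also have "\<bar>\<dots>\<bar> \<le> (\<Sum>z\<in>(UNIV::'s set). B * (2 * c + 1) * e)"
  proof (rule order.trans[OF sum_abs sum_mono])
    fix z
    have h1: "\<bar>A z - real K * \<rho> z True t\<bar> \<le> c * e"
      using close[of z] by (simp add: A_def e_def)
    have h0: "\<bar>N z - A z - real K * \<rho> z False t\<bar> \<le> (c + 1) * e"
      using h1 dev[of z] by (simp add: algebra_simps)
    have "\<bar>(A z - real K * \<rho> z True t) * F z True + (N z - A z - real K * \<rho> z False t) * F z False\<bar>
        \<le> \<bar>A z - real K * \<rho> z True t\<bar> * \<bar>F z True\<bar> + \<bar>N z - A z - real K * \<rho> z False t\<bar> * \<bar>F z False\<bar>"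
      by (metis abs_mult abs_triangle_ineq)
    also have "\<dots> \<le> (c * e) * B + ((c + 1) * e) * B"
      using c e B F by (intro add_mono mult_mono h1 h0) auto
    finally show "\<bar>(A z - real K * \<rho> z True t) * F z True + (N z - A z - real K * \<rho> z False t) * F z False\<bar>
        \<le> B * (2 * c + 1) * e" by (simp add: algebra_simps)
  qed
  finally show ?thesis by (simp add: e_def mult_ac)
qed

text \<open>One transition: the deviation grows by a factor, and by fluctuations of order \<open>\<surd>K\<close>.\<close>

lemma expected_deviation_le:
  fixes P :: "'s::finite kernel"
  assumes flow: "flow_measure T P s1 \<rho>" and t: "1 \<le> t" "t < T" and K: "1 \<le> K"
    and close: "\<And>z. \<bar>real (card {x. x < K \<and> s x = z \<and> a x}) - real K * \<rho> z True t\<bar> \<le> c * (deviation \<rho> K t s + 1)"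
    and c: "0 \<le> c"
  shows "measure_pmf.expectation (joint_kernel P s1 K s a) (deviation \<rho> K (Suc t))
       \<le> real CARD('s) * (sqrt (real K) + real CARD('s) * (2 * c + 1) * (deviation \<rho> K t s + 1))"
proof -
  let ?E = "measure_pmf.expectation (joint_kernel P s1 K s a)"
  let ?n = "\<lambda>z. real K * (\<rho> z False (Suc t) + \<rho> z True (Suc t))"
  let ?p = "\<lambda>z. \<Sum>x<K. pmf (P (a x) (s x)) z"
  let ?d = "real CARD('s) * (2 * c + 1) * (deviation \<rho> K t s + 1)"
  note int = integrable_measure_pmf_finite[OF finite_set_joint_kernel]
  have "?E (\<lambda>s'. \<bar>real (num_in_state K s' z) - ?n z\<bar>) \<le> sqrt (real K) + ?d" for z
  proof -
    have n: "?n z = real K * (\<Sum>b\<in>UNIV. \<Sum>z'\<in>UNIV. \<rho> z' b t * pmf (P b z') z)"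
      using flow_measure_step[OF flow t, of z] by (simp add: UNIV_bool)
    have "\<bar>?p z - ?n z\<bar> \<le> 1 * (real CARD('s) * (2 * c + 1)) * (deviation \<rho> K t s + 1)"
      unfolding n
      by (rule sum_over_arms_close[where F = "\<lambda>z' b. pmf (P b z') z"]) (use close c in \<open>auto simp: pmf_le_1\<close>)
    then have "\<bar>real (num_in_state K s' z) - ?n z\<bar> \<le> \<bar>real (num_in_state K s' z) - ?p z\<bar> + ?d" for s'
      by simp
    then have "?E (\<lambda>s'. \<bar>real (num_in_state K s' z) - ?n z\<bar>)
        \<le> ?E (\<lambda>s'. \<bar>real (num_in_state K s' z) - ?p z\<bar> + ?d)"
      by (rule expectation_mono_finite[OF finite_set_joint_kernel])
    also have "\<dots> \<le> sqrt (real K) + ?d"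
      using state_count_deviation[OF K, of P s1 s a z] by (simp add: int)
    finally show ?thesis .
  qed
  then have "(\<Sum>z\<in>UNIV. ?E (\<lambda>s'. \<bar>real (num_in_state K s' z) - ?n z\<bar>)) \<le> (\<Sum>z\<in>(UNIV::'s set). sqrt (real K) + ?d)"
    by (intro sum_mono)
  moreover have "deviation \<rho> K (Suc t) = (\<lambda>s'. \<Sum>z\<in>UNIV. \<bar>real (num_in_state K s' z) - ?n z\<bar>)"
    by (simp add: fun_eq_iff deviation_def)
  ultimately show ?thesis by (simp add: int)
qed

text \<open>
  The remaining reward under the occupation measure, minus a multiple of the deviation and of \<open>\<surd>K\<close>,
  is a potential that the index policy never undercuts in expectation.
\<close>

lemma index_policy_reward_ge:
  fixes P :: "'s::finite kernel"
  assumes min: "\<And>lam'. tail_val T P r lam 1 s1 + \<alpha> * (\<Sum>t=1..T. lam t)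
       \<le> tail_val T P r lam' 1 s1 + \<alpha> * (\<Sum>t=1..T. lam' t)"
    and opt: "occupation_optimal T P r s1 \<alpha> lam \<rho>"
    and states: "distinct states" "set states = UNIV"
  obtains C where "\<And>m K \<pi>. index_policy T P r states lam \<rho> m K \<pi> \<Longrightarrow> 1 \<le> m \<Longrightarrow> m \<le> K \<Longrightarrow>
      \<alpha> * real K - 1 \<le> real m \<Longrightarrow> real m \<le> \<alpha> * real K \<Longrightarrow>
      real K * (tail_val T P r lam 1 s1 + \<alpha> * (\<Sum>t=1..T. lam t)) - C * sqrt (real K)
      \<le> total_reward T P r s1 K \<pi>"
proof
  define S where "S = real CARD('s)"
  define c where "c = 2 * S + 1"
  define c' where "c' = S * (2 * c + 1)"
  define B where "B = (\<Sum>t=1..T. \<Sum>b\<in>UNIV. \<Sum>z\<in>UNIV. \<bar>r t z b\<bar>)"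
  define G where "G = S + S * c' + 1"
  \<comment> \<open>The loss per unit of deviation, from time \<open>t\<close> on.\<close>
  define C where "C t = B * c' * (\<Sum>j<Suc T - t. G ^ j)" for t
  have S: "0 \<le> S" by (simp add: S_def)
  have c: "0 \<le> c" "0 \<le> c'" using S by (simp_all add: c_def c'_def)
  have B: "0 \<le> B" by (simp add: B_def sum_nonneg)
  have G: "0 \<le> G" using S c by (simp add: G_def)
  have C_nonneg: "0 \<le> C t" for t using B c G by (simp add: C_def sum_nonneg)
  have C_step: "C t = B * c' + G * C (Suc t)" if "t \<le> T" for t
  proof -
    have "Suc T - t = Suc (Suc T - Suc t)" using that by simp
    then show ?thesis
      by (simp add: C_def sum.lessThan_Suc_shift sum_distrib_left algebra_simps del: sum.lessThan_Suc)
  qed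
  have rB: "\<bar>r t z b\<bar> \<le> B" if "t \<in> {1..T}" for t z b
  proof -
    have "\<bar>r t z b\<bar> \<le> (\<Sum>z\<in>UNIV. \<bar>r t z b\<bar>)" by (rule member_le_sum) auto
    also have "\<dots> \<le> (\<Sum>b\<in>UNIV. \<Sum>z\<in>UNIV. \<bar>r t z b\<bar>)"
      by (rule member_le_sum[of b UNIV "\<lambda>b. \<Sum>z\<in>UNIV. \<bar>r t z b\<bar>"]) (auto intro: sum_nonneg)
    also have "\<dots> \<le> B"
      unfolding B_def by (rule member_le_sum) (use that in \<open>auto intro!: sum_nonneg\<close>)
    finally show ?thesis .
  qed
  have flow: "flow_measure T P s1 \<rho>" and act: "\<And>t. t \<in> {1..T} \<Longrightarrow> (\<Sum>s\<in>UNIV. \<rho> s True t) = \<alpha>"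
    using opt by (auto simp: occupation_optimal_def occupation_feasible_iff)
  \<comment> \<open>Uncharged reward per arm under the occupation measure, from time \<open>t\<close> on.\<close>
  define L where "L t = (\<Sum>i=t..T. \<Sum>b\<in>UNIV. \<Sum>z\<in>UNIV. \<rho> z b i * r i z b)" for t
  have "occupation_objective T r (\<lambda>_. 0) \<rho>
      = occupation_objective T r lam \<rho> + (\<Sum>t=1..T. lam t * (\<Sum>s\<in>UNIV. \<rho> s True t))"
    using occupation_objective_shift[of T r lam "\<lambda>t. - lam t" \<rho>] by (simp add: sum_negf)
  also have "(\<Sum>t=1..T. lam t * (\<Sum>s\<in>UNIV. \<rho> s True t)) = \<alpha> * (\<Sum>t=1..T. lam t)"
    by (simp add: act sum_distrib_left mult.commute)
  finally have L1: "L 1 = tail_val T P r lam 1 s1 + \<alpha> * (\<Sum>t=1..T. lam t)"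
    using occupation_optimal_value[OF min opt] by (simp add: L_def occupation_objective_def)
  fix m K \<pi>
  assume pol: "index_policy T P r states lam \<rho> m K \<pi>" and m: "1 \<le> m" "m \<le> K"
    and m_\<alpha>: "\<alpha> * real K - 1 \<le> real m" "real m \<le> \<alpha> * real K"
  define \<phi> where "\<phi> t s = real K * L t - C t * (deviation \<rho> K t s + sqrt (real K))" for t and s :: "nat \<Rightarrow> 's"
  have sqrtK: "1 \<le> sqrt (real K)" using m by simp
  note int = integrable_measure_pmf_finite[OF finite_set_joint_kernel]
  have "\<phi> 1 (\<lambda>_. s1) \<le> run_value (joint_kernel P s1 K) \<pi> (joint_reward r K) T 1 (\<lambda>_. s1)"
  proof (rule run_value_ge)
    fix t s a assume "1 \<le> t" "t < 1 + T" and a: "a \<in> set_pmf (\<pi> t s)"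
    then have t: "t \<in> {1..T}" by simp
    define e where "e = deviation \<rho> K t s + sqrt (real K)"
    have e: "deviation \<rho> K t s + 1 \<le> e" "sqrt (real K) \<le> e"
      using sqrtK deviation_nonneg[of \<rho> K t s] by (simp_all add: e_def)
    note close = index_policy_activation_close[OF min opt pol m m_\<alpha> states t a, folded S_def, folded c_def]
    have "\<bar>joint_reward r K t s a - real K * (\<Sum>b\<in>UNIV. \<Sum>z\<in>UNIV. \<rho> z b t * r t z b)\<bar>
        \<le> B * c' * (deviation \<rho> K t s + 1)"
      using sum_over_arms_close[OF close c(1), of "r t" B] rB[OF t]
      by (simp add: joint_reward_def c'_def S_def)
    also have "\<dots> \<le> B * c' * e"
      using e B c by (intro mult_left_mono) auto
    finally have reward: "real K * (\<Sum>b\<in>UNIV. \<Sum>z\<in>UNIV. \<rho> z b t * r t z b) - B * c' * e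
        \<le> joint_reward r K t s a" by linarith
    have continuation: "C (Suc t) * (measure_pmf.expectation (joint_kernel P s1 K s a) (deviation \<rho> K (Suc t)) + sqrt (real K))
        \<le> C (Suc t) * (G * e)"
    proof (cases "t < T")
      case True
      have "measure_pmf.expectation (joint_kernel P s1 K s a) (deviation \<rho> K (Suc t))
          \<le> S * (sqrt (real K) + c' * (deviation \<rho> K t s + 1))"
        using expected_deviation_le[OF flow _ True _ close c(1)] t m by (simp add: S_def c'_def)
      also have "\<dots> \<le> S * (e + c' * e)"
        using e S c by (intro mult_left_mono add_mono) auto
      finally have "measure_pmf.expectation (joint_kernel P s1 K s a) (deviation \<rho> K (Suc t)) + sqrt (real K) \<le> G * e"
        using e by (simp add: G_def algebra_simps)
      then show ?thesis by (rule mult_left_mono[OF _ C_nonneg])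
    next
      case False
      \<comment> \<open>After the horizon nothing is left to lose.\<close>
      then have "C (Suc t) = 0" using t by (simp add: C_def)
      then show ?thesis by simp
    qed
    have "L t = (\<Sum>b\<in>UNIV. \<Sum>z\<in>UNIV. \<rho> z b t * r t z b) + L (Suc t)"
      using t by (simp add: L_def sum.atLeast_Suc_atMost)
    moreover have "\<phi> t s = real K * L t - C t * e" by (simp add: \<phi>_def e_def)
    ultimately have "\<phi> t s = real K * (\<Sum>b\<in>UNIV. \<Sum>z\<in>UNIV. \<rho> z b t * r t z b) - B * c' * e
        + real K * L (Suc t) - C (Suc t) * (G * e)"
      using C_step[of t] t by (simp add: algebra_simps)
    also have "\<dots> \<le> joint_reward r K t s a + real K * L (Suc t)
        - C (Suc t) * (measure_pmf.expectation (joint_kernel P s1 K s a) (deviation \<rho> K (Suc t)) + sqrt (real K))"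
      using reward continuation by linarith
    also have "\<dots> = joint_reward r K t s a + measure_pmf.expectation (joint_kernel P s1 K s a) (\<phi> (Suc t))"
    proof -
      have "\<phi> (Suc t) = (\<lambda>s'. real K * L (Suc t) - C (Suc t) * (deviation \<rho> K (Suc t) s' + sqrt (real K)))"
        by (simp add: fun_eq_iff \<phi>_def)
      then show ?thesis by (simp add: int)
    qed
    finally show "\<phi> t s \<le> joint_reward r K t s a
        + measure_pmf.expectation (joint_kernel P s1 K s a) (\<phi> (Suc t))" .
  next
    show "finite (set_pmf (\<pi> t s))" for t s
      using pol finite_set_policy[of \<pi> K] by (simp add: index_policy_def)
  qed (auto simp: finite_set_joint_kernel \<phi>_def L_def C_def)
  moreover have "deviation \<rho> K 1 (\<lambda>_. s1) = 0"
  proof -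
    have "real (num_in_state K (\<lambda>_. s1) z) = real K * (\<rho> z False 1 + \<rho> z True 1)" for z
      using flow_measure_init[OF flow, of z] by (simp add: num_in_state_eq_sum UNIV_bool eq_commute)
    then show ?thesis by (simp add: deviation_def)
  qed
  ultimately show "real K * (tail_val T P r lam 1 s1 + \<alpha> * (\<Sum>t=1..T. lam t)) - C 1 * sqrt (real K)
      \<le> total_reward T P r s1 K \<pi>"
    unfolding total_reward_eq by (simp add: \<phi>_def L1 del: One_nat_def)
qed



section \<open>Asymptotic optimality\<close>


section \<open>Asymptotic optimality\<close>

theorem theorem1:
  fixes T :: nat
    and P :: "'s::finite kernel"
    and r :: "'s reward"
    and s1 :: 's
    and \<alpha> :: real
    and lam :: "nat \<Rightarrow> real"
    and K0 :: nat
    and \<rho> :: "'s \<Rightarrow> bool \<Rightarrow> nat \<Rightarrow> real"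
    and states :: "'s list"
    and \<pi>hat :: "nat \<Rightarrow> (nat \<Rightarrow> 's, nat \<Rightarrow> bool) policy"
  assumes "\<And>t s a. t \<in> {1..T} \<Longrightarrow> 0 \<le> r t s a"
    and "0 < \<alpha>" and "\<alpha> < 1"
    and "1 \<le> K0" and "lam \<in> multipliers T P r s1 \<alpha> K0"
    and "occupation_optimal T P r s1 \<alpha> lam \<rho>"
    and "distinct states" and "set states = UNIV"
    and "\<And>K. 1 \<le> nat \<lfloor>\<alpha> * real K\<rfloor> \<Longrightarrow>
           index_policy T P r states lam \<rho> (nat \<lfloor>\<alpha> * real K\<rfloor>) K (\<pi>hat K)"
  shows "(\<lambda>K. (total_reward T P r s1 K (\<pi>hat K)
                - (SUP \<pi>\<in>policies_active T P s1 (nat \<lfloor>\<alpha> * real K\<rfloor>) K.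
                     total_reward T P r s1 K \<pi>)) / real K)
         \<longlonglongrightarrow> 0"
proof -
  note \<alpha> = assms(2,3) and opt = assms(6) and states = assms(7,8) and pol = assms(9)
  note min = multiplier_minimizes[OF assms(4,5)]
  define Lam where "Lam = (\<Sum>t=1..T. lam t)"
  obtain C where C: "\<And>m K \<pi>. index_policy T P r states lam \<rho> m K \<pi> \<Longrightarrow> 1 \<le> m \<Longrightarrow> m \<le> K \<Longrightarrow>
      \<alpha> * real K - 1 \<le> real m \<Longrightarrow> real m \<le> \<alpha> * real K \<Longrightarrow>
      real K * (tail_val T P r lam 1 s1 + \<alpha> * Lam) - C * sqrt (real K) \<le> total_reward T P r s1 K \<pi>"
    unfolding Lam_def by (rule index_policy_reward_ge[OF min opt states]) blast
  let ?gap = "\<lambda>K. (total_reward T P r s1 K (\<pi>hat K)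
                - (SUP \<pi>\<in>policies_active T P s1 (nat \<lfloor>\<alpha> * real K\<rfloor>) K.
                     total_reward T P r s1 K \<pi>)) / real K"
  \<comment> \<open>The condition on \<open>K\<close> ensures at least one activation per period; the term in \<open>Lam\<close> comes from
    rounding \<open>\<alpha> * K\<close> down.\<close>
  have bounds: "- (C / sqrt (real K) + \<bar>Lam\<bar> / real K) \<le> ?gap K \<and> ?gap K \<le> 0"
    if K: "1 / \<alpha> \<le> real K" for K
  proof -
    define m where "m = nat \<lfloor>\<alpha> * real K\<rfloor>"
    have "1 \<le> \<alpha> * real K" using K \<alpha> by (simp add: field_simps)
    then have m1: "1 \<le> m" unfolding m_def by linarith
    have m_\<alpha>: "\<alpha> * real K - 1 \<le> real m" "real m \<le> \<alpha> * real K"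
      using \<open>1 \<le> \<alpha> * real K\<close> unfolding m_def by linarith+
    have "\<alpha> * real K \<le> real K" using \<alpha> by (simp add: mult_left_le_one_le)
    then have mK: "m \<le> K" using m_\<alpha> by linarith
    have K0: "0 < real K" using m1 mK by simp
    have pol': "index_policy T P r states lam \<rho> m K (\<pi>hat K)"
      using pol[of K] m1 by (simp add: m_def)
    have "\<And>t s. t \<in> {1..T} \<Longrightarrow> 0 \<le> \<rho> s True t"
      using opt flow_measure_nonneg[of T P s1 \<rho>] by (simp add: occupation_optimal_def occupation_feasible_iff)
    then have active: "\<pi>hat K \<in> policies_active T P s1 m K"
      by (rule index_policy_active[OF pol' m1 mK states])
    let ?V = "SUP \<pi>\<in>policies_active T P s1 m K. total_reward T P r s1 K \<pi>"
    note upper = total_reward_le[of _ T P s1 m K r lam, folded Lam_def]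
    have "bdd_above (total_reward T P r s1 K ` policies_active T P s1 m K)"
      using upper by (rule bdd_aboveI2)
    then have le: "total_reward T P r s1 K (\<pi>hat K) \<le> ?V"
      by (rule cSUP_upper[OF active])
    have "?V \<le> real K * tail_val T P r lam 1 s1 + real m * Lam"
      using active upper by (intro cSUP_least) auto
    moreover have "real K * tail_val T P r lam 1 s1 + real K * \<alpha> * Lam - C * sqrt (real K) \<le> total_reward T P r s1 K (\<pi>hat K)"
      using C[OF pol' m1 mK m_\<alpha>] by (simp add: algebra_simps)
    moreover have "(real m - \<alpha> * real K) * Lam \<le> 1 * \<bar>Lam\<bar>"
    proof -
      have "(real m - \<alpha> * real K) * Lam \<le> \<bar>real m - \<alpha> * real K\<bar> * \<bar>Lam\<bar>"
        by (metis abs_ge_self abs_mult)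
      also have "\<dots> \<le> 1 * \<bar>Lam\<bar>" using m_\<alpha> by (intro mult_right_mono) auto
      finally show ?thesis .
    qed
    ultimately have "- (C * sqrt (real K) + \<bar>Lam\<bar>) \<le> total_reward T P r s1 K (\<pi>hat K) - ?V"
      by (simp add: algebra_simps)
    then have "- (C * sqrt (real K) + \<bar>Lam\<bar>) / real K \<le> (total_reward T P r s1 K (\<pi>hat K) - ?V) / real K"
      using K0 by (intro divide_right_mono) auto
    moreover have "- (C * sqrt (real K) + \<bar>Lam\<bar>) / real K = - (C / sqrt (real K) + \<bar>Lam\<bar> / real K)"
      using K0 by (simp add: field_simps)
    moreover have "(total_reward T P r s1 K (\<pi>hat K) - ?V) / real K \<le> 0"
      using le K0 by (simp add: divide_nonpos_pos)
    ultimately show ?thesis unfolding m_def by simp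
  qed
  have ev: "\<forall>\<^sub>F K in sequentially. 1 / \<alpha> \<le> real K"
    using filterlim_real_sequentially unfolding filterlim_at_top by blast
  show ?thesis
  proof (rule tendsto_sandwich)
    show "\<forall>\<^sub>F K in sequentially. - (C / sqrt (real K) + \<bar>Lam\<bar> / real K) \<le> ?gap K"
      using ev by (rule eventually_mono) (use bounds in blast)
    show "\<forall>\<^sub>F K in sequentially. ?gap K \<le> 0"
      using ev by (rule eventually_mono) (use bounds in blast)
    have "filterlim (\<lambda>K. sqrt (real K)) at_top sequentially"
      by (rule filterlim_compose[OF sqrt_at_top filterlim_real_sequentially])
    then have "(\<lambda>K. C / sqrt (real K)) \<longlonglongrightarrow> 0"
      by (rule real_tendsto_divide_at_top[OF tendsto_const])
    moreover have "(\<lambda>K. \<bar>Lam\<bar> / real K) \<longlonglongrightarrow> 0"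
      by (rule real_tendsto_divide_at_top[OF tendsto_const filterlim_real_sequentially])
    ultimately show "(\<lambda>K. - (C / sqrt (real K) + \<bar>Lam\<bar> / real K)) \<longlonglongrightarrow> 0"
      using tendsto_minus[OF tendsto_add] by fastforce
  qed simp
qed

end
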